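(* Let $\mu$ be a probability measure on the real line with compact support $K$ and algebraic Stieltjes transform $S(z)=\int\frac{\mu(dx)}{z-x}$. Let $F(X,Y)\in\mathbb C[X,Y]$ be a not-identically-vanishing polynomial such that $F(z,S(z))=0$ for all $z\in\mathbb C\setminus K$ and such that the discriminant $D(X)$ of $F(X,Y)$ with respect to $Y$ does not vanish identically. Let $n$ be the degree of $F(X,Y)$ in $Y$, write $F(X,Y)=\sum_{i=0}^nF_i(X)Y^i$, and let $A$ be the (finite) set of complex zeroes of $F_n(X)D(X)$. Let $I$ be a connected component of $\mathbb R\setminus A$ and let $\mu|_I$ be the restriction of $\mu$ to (the Borel subsets of) $I$. If $I\setminus K$ is nonempty, then $\mu|_I$ vanishes identically. If $I$ is bounded and $\mu|_I$ does not vanish identically, then $\mu|_I$ has density of rational beta type with respect to Lebesgue measure.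
   Context: A real-valued function $h$ defined in a bounded open interval $(a,b)$ is of *rational beta type* if: (1) $h$ is real-analytic and nonnegative on $(a,b)$; and (2) there exist positive rational numbers $c$ and $d$ such that both limits $\lim_{x\downarrow a}(x-a)^{1-c}h(x)$ and $\lim_{x\uparrow b}(b-x)^{1-d}h(x)$ exist and are positive. The Stieltjes transform $S$ is called algebraic if there is a not-identically-vanishing polynomial $F(X,Y)$ with complex coefficients such that $F(z,S(z))=0$ for all $z\in\mathbb C\setminus K$. *)

theory Defs
  imports "HOL-Probability.Probability" "Subresultants.Resultant_Prelim"
begin

text \<open>
  A polynomial \<open>F(X,Y)\<close> is represented as an element of \<open>complex poly poly\<close>: the outer
  variable is \<open>Y\<close> and the coefficients \<open>coeff F i\<close> are the polynomials \<open>F\<^sub>i(X)\<close>.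
\<close>

definition bipoly_eval :: "complex poly poly \<Rightarrow> complex \<Rightarrow> complex \<Rightarrow> complex" where
  "bipoly_eval F x y = (\<Sum>i\<le>degree F. poly (coeff F i) x * y ^ i)"

text \<open>
  The usual normalisation \<open>(-1)\<^bsup>n(n-1)/2\<^esup> Res(p, p') / lc(p)\<close>, so that the discriminant
  of a linear polynomial is 1 and that of \<open>a Y\<^sup>2 + b Y + c\<close> is \<open>b\<^sup>2 - 4ac\<close>. The
  division is exact in positive degree, see \<open>lead_coeff_dvd_resultant_pderiv\<close> below.
  Characteristic 0 ensures that \<open>pderiv p\<close> has degree \<open>degree p - 1\<close>, so that
  \<open>resultant\<close>, which uses the actual degrees, is the determinant of the expected size.
\<close>

definition discriminant :: "'a :: {idom_divide, semiring_char_0} poly \<Rightarrow> 'a" where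
  "discriminant p =
     (- 1) ^ (degree p choose 2) * (resultant p (pderiv p) div lead_coeff p)"

lemma lead_coeff_dvd_resultant_pderiv:
  fixes p :: "'a :: {idom_divide, semiring_char_0} poly"
  assumes "degree p > 0"
  shows "lead_coeff p dvd resultant p (pderiv p)"
proof -
  let ?q = "pderiv p" let ?A = "sylvester_mat p ?q"
  let ?d = "degree p + degree ?q"
  have dq: "degree ?q = degree p - 1" by (rule degree_pderiv)
  have A: "?A \<in> carrier_mat ?d ?d" by (rule sylvester_carrier_mat)
  have "coeff ?q (degree p - 1) = of_nat (degree p) * lead_coeff p"
    using assms by (simp add: coeff_pderiv)
  then have "lead_coeff p dvd coeff ?q (degree p - 1)" by simp
  moreover have "i = degree p - 1" if "i < degree p" "\<not> i < degree p - 1" for i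
    using that by simp
  ultimately have q: "lead_coeff p dvd coeff ?q i"
    if "i < degree p" "\<not> i < degree p - 1" for i
    using that by metis
  have "lead_coeff p dvd ?A $$ (i, 0)" if "i < ?d" for i
    using that assms dq q by (auto simp: sylvester_index_mat)
  moreover have "resultant p ?q = (\<Sum>i<?d. ?A $$ (i, 0) * cofactor ?A i 0)"
    unfolding resultant_def using laplace_expansion_column[OF A, of 0] assms by simp
  ultimately show ?thesis by (auto intro!: dvd_sum dvd_mult2)
qed

text \<open>The (closed) support: the complement of the largest open null set.\<close>

definition measure_support :: "real measure \<Rightarrow> real set" where
  "measure_support \<mu> = {x. \<forall>U. open U \<longrightarrow> x \<in> U \<longrightarrow> emeasure \<mu> U > 0}"

definition stieltjes :: "real measure \<Rightarrow> complex \<Rightarrow> complex" where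
  "stieltjes \<mu> z = (LINT x|\<mu>. 1 / (z - complex_of_real x))"

definition annihilates_stieltjes :: "complex poly poly \<Rightarrow> real measure \<Rightarrow> bool" where
  "annihilates_stieltjes F \<mu> \<longleftrightarrow>
     (\<forall>z. z \<notin> complex_of_real ` measure_support \<mu> \<longrightarrow> bipoly_eval F z (stieltjes \<mu> z) = 0)"

definition algebraic_stieltjes :: "real measure \<Rightarrow> bool" where
  "algebraic_stieltjes \<mu> \<longleftrightarrow> (\<exists>F. F \<noteq> 0 \<and> annihilates_stieltjes F \<mu>)"

text \<open>Intended for open \<open>S\<close>: locally a convergent power series with real coefficients.\<close>

definition real_analytic_on :: "(real \<Rightarrow> real) \<Rightarrow> real set \<Rightarrow> bool" where
  "real_analytic_on h S \<longleftrightarrow>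
     (\<forall>x\<^sub>0\<in>S. \<exists>r>0. \<exists>c :: nat \<Rightarrow> real. \<forall>x\<in>ball x\<^sub>0 r. (\<lambda>n. c n * (x - x\<^sub>0) ^ n) sums h x)"

text \<open>The values of \<open>h\<close> outside \<open>(a, b)\<close> are irrelevant.\<close>

definition rational_beta_type :: "real \<Rightarrow> real \<Rightarrow> (real \<Rightarrow> real) \<Rightarrow> bool" where
  "rational_beta_type a b h \<longleftrightarrow>
     a < b \<and> real_analytic_on h {a<..<b} \<and> (\<forall>x\<in>{a<..<b}. 0 \<le> h x) \<and>
     (\<exists>c\<in>\<rat>. \<exists>d\<in>\<rat>. 0 < c \<and> 0 < d \<and>
        (\<exists>L>0. ((\<lambda>x. (x - a) powr (1 - c) * h x) \<longlongrightarrow> L) (at_right a)) \<and>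
        (\<exists>L>0. ((\<lambda>x. (b - x) powr (1 - d) * h x) \<longlongrightarrow> L) (at_left b)))"

end

theory Submission
  imports Defs "HOL-Complex_Analysis.Complex_Analysis"
    "HOL-Computational_Algebra.Fundamental_Theorem_Algebra"
    "HOL-Computational_Algebra.Field_as_Ring" "Subresultants.Subresultant_Gcd"
begin

text \<open>
  Away from \<open>A\<close> the polynomial \<open>F(z, Y)\<close> has \<open>n\<close> distinct roots, so the curve \<open>F = 0\<close> is an
  \<open>n\<close>-sheeted covering of \<open>\<complex> - A\<close>. Lifting the inclusion of a thin strip around \<open>I\<close>
  yields a holomorphic \<open>y\<close> that equals the Stieltjes transform on the upper half of the strip;
  by Stieltjes inversion \<open>\<mu>\<close> has density \<open>- Im y / \<pi>\<close> on \<open>I\<close>. This density is analytic, so it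
  vanishes on \<open>I\<close> as soon as it vanishes on a subinterval, e.g. outside the support.
  Near an endpoint \<open>p\<close>, lifting \<open>u \<mapsto> p \<plusminus> exp u\<close> on a left half-plane gives a function with
  period \<open>2 \<pi> \<i> m\<close>, because two of the \<open>n + 1\<close> translates by \<open>0, 2 \<pi> \<i>, \<dots>, 2 \<pi> \<i> n\<close> agree. Hence \<open>y\<close> is
  meromorphic in the \<open>m\<close>-th root of the distance to \<open>p\<close>, the density behaves like a rational power of that
  distance, and the exponent exceeds \<open>-1\<close> because \<open>\<mu>\<close> is finite.
\<close>

section \<open>Roots of a polynomial with analytic coefficients\<close>

text \<open>Only values in the upper half-plane enter from the Stieltjes transform: the continuation
  \<open>y\<close> starts there and crosses \<open>I\<close>, even where \<open>I\<close> lies in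
  the support and the transform itself jumps. Below the axis \<open>y\<close> need not agree with
  the transform. Lifting to a covering needs a simply connected base. Strips are convex, and near an
  endpoint the exponential replaces the punctured disc by a half-plane, so that neither slit discs
  nor monodromy groups occur. The imaginary part of a holomorphic function is not holomorphic, which
  blocks the identity theorem and order-of-vanishing arguments for the density. The remedy is
  \<open>f z - cnj (f (cnj z))\<close>, holomorphic on a symmetric domain and equal to
  \<open>2 * \<i> * Im (f z)\<close> on the real axis. Its order of vanishing determines the
  rational exponent at an endpoint, and nonnegativity of the density makes the leading constant
  positive. Inversion gives the endpoints of a test interval only half weight, so atoms in
  \<open>I\<close> have to be excluded before the density can be read off; local boundedness of the
  boundary values does this.\<close>

definition fibre_poly :: "complex poly poly \<Rightarrow> complex \<Rightarrow> complex poly" where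
  "fibre_poly F x = map_poly (\<lambda>p. poly p x) F"

text \<open>The complement of the set \<open>A\<close> of the theorem. In positive degree, these are
  the points where no root in \<open>Y\<close> escapes to infinity and no two roots collide.\<close>

definition regular_points :: "complex poly poly \<Rightarrow> complex set" where
  "regular_points F = {x. poly (lead_coeff F * discriminant F) x \<noteq> 0}"

lemma coeff_fibre_poly [simp]: "coeff (fibre_poly F x) i = poly (coeff F i) x"
  by (simp add: fibre_poly_def coeff_map_poly)

lemma degree_fibre_poly_le: "degree (fibre_poly F x) \<le> degree F"
  by (simp add: fibre_poly_def degree_map_poly_le)

lemma poly_fibre_poly: "poly (fibre_poly F x) y = bipoly_eval F x y"
proof -
  have "poly (fibre_poly F x) y = (\<Sum>i\<le>degree F. coeff (fibre_poly F x) i * y ^ i)"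
    unfolding poly_altdef
    by (rule sum.mono_neutral_left) (use degree_fibre_poly_le in \<open>auto simp: coeff_eq_0 not_le simp del: coeff_fibre_poly\<close>)
  then show ?thesis by (simp add: bipoly_eval_def)
qed

lemma degree_fibre_poly:
  assumes "poly (lead_coeff F) x \<noteq> 0"
  shows "degree (fibre_poly F x) = degree F"
  using assms degree_fibre_poly_le[of F x] le_degree[of "fibre_poly F x" "degree F"] by simp

lemma pderiv_fibre_poly: "pderiv (fibre_poly F x) = fibre_poly (pderiv F) x"
  by (rule poly_eqI) (simp add: coeff_pderiv)

text \<open>The factor \<open>lead_coeff F\<close> cancels the exact division in
  \<open>discriminant\<close>, so regularity of a point becomes nonvanishing of a resultant.\<close>

lemma lead_coeff_mult_discriminant:
  assumes "degree F > 0"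
  shows "lead_coeff F * discriminant F = (- 1) ^ (degree F choose 2) * resultant F (pderiv F)"
  using lead_coeff_dvd_resultant_pderiv[OF assms] unfolding discriminant_def by (simp add: ac_simps)

text \<open>At a regular point the leading coefficient survives, so \<open>F\<close> and
  \<open>pderiv F\<close> keep their degrees and the resultant commutes with evaluation in
  \<open>X\<close>. Its nonvanishing makes the fibre coprime to its derivative, which excludes
  double roots.\<close>

lemma rsquarefree_fibre_poly:
  assumes "degree F > 0" "x \<in> regular_points F"
  shows "rsquarefree (fibre_poly F x)"
proof -
  have ne: "poly (lead_coeff F * discriminant F) x \<noteq> 0"
    using assms by (simp add: regular_points_def)
  then have lc: "poly (lead_coeff F) x \<noteq> 0" by auto
  note deg = degree_fibre_poly[OF lc]
  have "degree (fibre_poly (pderiv F) x) = degree (pderiv F)"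
    by (metis deg degree_pderiv pderiv_fibre_poly)
  then have "resultant (fibre_poly F x) (fibre_poly (pderiv F) x) = poly (resultant F (pderiv F)) x"
    using deg unfolding fibre_poly_def by (intro poly_hom.resultant_map_poly)
  moreover have "poly (resultant F (pderiv F)) x \<noteq> 0"
    using ne unfolding lead_coeff_mult_discriminant[OF assms(1)] by auto
  ultimately have "resultant (fibre_poly F x) (pderiv (fibre_poly F x)) \<noteq> 0"
    by (simp add: pderiv_fibre_poly)
  then have "degree (gcd (fibre_poly F x) (pderiv (fibre_poly F x))) = 0"
    using resultant_0_gcd by blast
  moreover have "gcd (fibre_poly F x) (pderiv (fibre_poly F x)) \<noteq> 0"
    using deg assms(1) by auto
  ultimately have "is_unit (gcd (fibre_poly F x) (pderiv (fibre_poly F x)))"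
    by (simp add: is_unit_iff_degree)
  then have cop: "coprime (fibre_poly F x) (pderiv (fibre_poly F x))"
    using coprime_iff_gcd_eq_1 is_unit_gcd by blast
  show ?thesis
    unfolding rsquarefree_roots
  proof (intro allI notI)
    fix a assume "poly (fibre_poly F x) a = 0 \<and> poly (pderiv (fibre_poly F x)) a = 0"
    then have "[:-a, 1:] dvd fibre_poly F x" "[:-a, 1:] dvd pderiv (fibre_poly F x)"
      by (simp_all add: poly_eq_0_iff_dvd)
    with cop have "is_unit [:-a, 1:]" by (rule coprime_common_divisor)
    then show False by (simp add: is_unit_iff_degree)
  qed
qed

lemma card_roots:
  assumes "degree F > 0" "x \<in> regular_points F"
  shows "card {y. bipoly_eval F x y = 0} = degree F" "finite {y. bipoly_eval F x y = 0}"
proof -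
  let ?p = "fibre_poly F x"
  have lc: "poly (lead_coeff F) x \<noteq> 0" using assms by (auto simp: regular_points_def)
  note deg = degree_fibre_poly[OF lc]
  have p0: "?p \<noteq> 0" using deg assms by auto
  show "finite {y. bipoly_eval F x y = 0}"
    using poly_roots_finite[OF p0] by (simp add: poly_fibre_poly)
  have "degree (\<Prod>z|poly ?p z = 0. [:-z, 1:]) = degree ?p"
    using arg_cong[OF complex_poly_decompose_rsquarefree[OF rsquarefree_fibre_poly[OF assms]], of degree] p0
    by (simp only: degree_smult_eq leading_coeff_0_iff if_False)
  then show "card {y. bipoly_eval F x y = 0} = degree F"
    by (simp add: degree_prod_sum_eq deg poly_fibre_poly)
qed

section \<open>Continuous dependence and separation of the roots\<close>

text \<open>Factoring \<open>p\<close> shows that \<open>norm (poly p y)\<close> is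
  \<open>norm (lead_coeff p)\<close> times the product of the distances from \<open>y\<close> to the
  roots. If all of these were at least \<open>e\<close>, the product would be at least
  \<open>e ^ degree p\<close>.\<close>

lemma exists_root_near:
  fixes p :: "complex poly"
  assumes "degree p > 0" "e > 0" "norm (poly p y) < norm (lead_coeff p) * e ^ degree p"
  obtains r where "poly p r = 0" "dist r y < e"
proof -
  obtain root where r: "Polynomial.smult (lead_coeff p) (\<Prod>i<degree p. [:-root i, 1:]) = p"
    using complex_poly_decompose' by blast
  have root0: "poly p (root i) = 0" if "i < degree p" for i
    by (subst r[symmetric]) (use that in \<open>auto simp: poly_prod\<close>)
  have "\<exists>i<degree p. dist (root i) y < e"
  proof (rule ccontr)
    assume "\<not> ?thesis"
    then have *: "e \<le> norm (y - root i)" if "i < degree p" for i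
      using that by (auto simp: dist_norm norm_minus_commute)
    have "norm (lead_coeff p) * e ^ degree p \<le> norm (lead_coeff p) * (\<Prod>i<degree p. norm (y - root i))"
      using * \<open>e > 0\<close> prod_mono[of "{..<degree p}" "\<lambda>_. e" "\<lambda>i. norm (y - root i)"]
      by (intro mult_left_mono) auto
    also have "\<dots> = norm (poly p y)"
      by (subst (4) r[symmetric]) (simp add: poly_prod norm_mult prod_norm)
    finally show False using assms(3) by simp
  qed
  then show ?thesis using root0 that by blast
qed

lemma continuous_bipoly_eval [continuous_intros]:
  "continuous_on S f \<Longrightarrow> continuous_on S g \<Longrightarrow> continuous_on S (\<lambda>u. bipoly_eval F (f u) (g u))"
  unfolding bipoly_eval_def by (intro continuous_intros)

lemma open_regular_points: "open (regular_points F)"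
proof -
  have "regular_points F = (\<lambda>x. poly (lead_coeff F * discriminant F) x) -` (- {0})"
    by (auto simp: regular_points_def)
  moreover have "open \<dots>"
    by (rule open_vimage) (auto intro!: continuous_intros)
  ultimately show ?thesis by simp
qed

lemma isCont_tendsto_nhds: "isCont f x \<Longrightarrow> (f \<longlongrightarrow> f x) (nhds x)"
  using tendsto_at_iff_tendsto_nhds[of f x] by (simp only: isCont_def)

text \<open>At \<open>x0\<close> the inequality required by \<open>exists_root_near\<close> has left
  side \<open>0\<close> and a positive right side. Both sides are continuous in \<open>x\<close>, so
  it persists nearby.\<close>

lemma eventually_root_near:
  assumes "degree F > 0" "x0 \<in> regular_points F" "bipoly_eval F x0 y0 = 0" "e > 0"
  shows "\<forall>\<^sub>F x in nhds x0. \<exists>y\<in>ball y0 e. bipoly_eval F x y = 0"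
proof -
  let ?g = "\<lambda>x. norm (poly (lead_coeff F) x) * e ^ degree F - norm (bipoly_eval F x y0)"
  have lc: "poly (lead_coeff F) x0 \<noteq> 0" using assms by (auto simp: regular_points_def)
  have "continuous_on UNIV ?g"
    by (intro continuous_intros)
  then have "isCont ?g x0"
    by (simp add: continuous_on_eq_continuous_at)
  then have "(?g \<longlongrightarrow> ?g x0) (nhds x0)"
    by (rule isCont_tendsto_nhds)
  moreover have "?g x0 > 0" using lc assms by simp
  ultimately have "\<forall>\<^sub>F x in nhds x0. ?g x > 0"
    by (rule order_tendstoD)
  moreover have "\<forall>\<^sub>F x in nhds x0. x \<in> regular_points F"
    using assms open_regular_points eventually_nhds_in_open by blast
  ultimately show ?thesis
  proof eventually_elim
    case (elim x)
    then have lc: "poly (lead_coeff F) x \<noteq> 0" by (auto simp: regular_points_def)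
    note deg = degree_fibre_poly[OF lc]
    obtain r where "poly (fibre_poly F x) r = 0" "dist r y0 < e"
      using exists_root_near[of "fibre_poly F x" e y0] assms elim deg
      by (auto simp: poly_fibre_poly)
    then show ?case by (auto simp: poly_fibre_poly dist_commute)
  qed
qed

lemma finite_separated:
  fixes R :: "'a::metric_space set"
  assumes "finite R"
  obtains e where "e > 0" "pairwise (\<lambda>y y'. disjnt (ball y e) (ball y' e)) R"
proof -
  have "\<exists>e>0. \<forall>y\<in>R. \<forall>y'\<in>R. y \<noteq> y' \<longrightarrow> e \<le> dist y y'"
  proof -
    \<comment> \<open>The inserted \<open>1\<close> keeps the minimum defined when \<open>R\<close>
      has at most one point.\<close>
    let ?D = "insert 1 ((\<lambda>(y,y'). dist y y') ` {(y,y'). y\<in>R \<and> y'\<in>R \<and> y \<noteq> y'})"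
    have "{(y,y'). y\<in>R \<and> y'\<in>R \<and> y \<noteq> y'} \<subseteq> R \<times> R" by auto
    then have fin: "finite ?D"
      using assms by (simp add: finite_subset[OF _ finite_cartesian_product])
    have "Min ?D > 0" using fin by (subst Min_gr_iff) auto
    moreover have "Min ?D \<le> dist y y'" if "y \<in> R" "y' \<in> R" "y \<noteq> y'" for y y'
      using fin that by (intro Min_le) (auto intro!: rev_image_eqI[of "(y,y')"])
    ultimately show ?thesis by blast
  qed
  then obtain e where e: "e > 0" "\<And>y y'. y\<in>R \<Longrightarrow> y'\<in>R \<Longrightarrow> y \<noteq> y' \<Longrightarrow> e \<le> dist y y'"
    by blast
  show ?thesis
  proof (rule that[of "e/2"])
    show "pairwise (\<lambda>y y'. disjnt (ball y (e/2)) (ball y' (e/2))) R"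
      unfolding pairwise_def
    proof (intro ballI impI)
      fix y y' assume "y \<in> R" "y' \<in> R" "y \<noteq> y'"
      then have "e \<le> dist y y'" by (rule e)
      then have "False" if "dist y z < e/2" "dist y' z < e/2" for z
        using dist_triangle_half_r[of z y e y'] that by (auto simp: dist_commute)
      then show "disjnt (ball y (e/2)) (ball y' (e/2))"
        by (auto simp: disjnt_def)
    qed
  qed (use e in auto)
qed

text \<open>A counting argument: each of the \<open>degree F\<close> disjoint balls retains at least
  one root for \<open>x\<close> near \<open>x0\<close>, and there are only \<open>degree F\<close>
  roots altogether. So every ball holds exactly one root and none lies elsewhere.\<close>

lemma eventually_roots_separated:
  assumes "degree F > 0" "x0 \<in> regular_points F"
    and R_def: "R = {y. bipoly_eval F x0 y = 0}"
  obtains e where "e > 0" "pairwise (\<lambda>y y'. disjnt (ball y e) (ball y' e)) R"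
    "\<forall>\<^sub>F x in nhds x0. x \<in> regular_points F \<and> {y. bipoly_eval F x y = 0} \<subseteq> (\<Union>y0\<in>R. ball y0 e) \<and>
      (\<forall>y0\<in>R. \<exists>!y. y \<in> ball y0 e \<and> bipoly_eval F x y = 0)"
proof -
  note R = card_roots[OF assms(1,2), folded R_def]
  obtain e where e: "e > 0" "pairwise (\<lambda>y y'. disjnt (ball y e) (ball y' e)) R"
    using finite_separated[OF R(2)] by blast
  have "\<forall>\<^sub>F x in nhds x0. \<forall>y0\<in>R. \<exists>y\<in>ball y0 e. bipoly_eval F x y = 0"
    by (rule eventually_ball_finite[OF R(2)])
      (use assms e in \<open>auto intro!: eventually_root_near\<close>)
  moreover have "\<forall>\<^sub>F x in nhds x0. x \<in> regular_points F"
    using assms open_regular_points eventually_nhds_in_open by blast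
  ultimately have "\<forall>\<^sub>F x in nhds x0. x \<in> regular_points F \<and> {y. bipoly_eval F x y = 0} \<subseteq> (\<Union>y0\<in>R. ball y0 e) \<and>
      (\<forall>y0\<in>R. \<exists>!y. y \<in> ball y0 e \<and> bipoly_eval F x y = 0)"
  proof eventually_elim
    case (elim x)
    then obtain f where f: "\<And>y0. y0 \<in> R \<Longrightarrow> f y0 \<in> ball y0 e \<and> bipoly_eval F x (f y0) = 0"
      by metis
    have same: "y1 = y2" if "y1 \<in> R" "y2 \<in> R" "z \<in> ball y1 e" "z \<in> ball y2 e" for y1 y2 z
      using e(2) that unfolding pairwise_def disjnt_def by blast
    have inj: "inj_on f R"
      by (rule inj_onI) (metis f same)
    have im: "f ` R = {y. bipoly_eval F x y = 0}"
    proof (rule card_subset_eq)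
      show "finite {y. bipoly_eval F x y = 0}"
        using card_roots[OF assms(1)] elim by blast
      show "f ` R \<subseteq> {y. bipoly_eval F x y = 0}" using f by blast
      show "card (f ` R) = card {y. bipoly_eval F x y = 0}"
        using card_roots(1)[OF assms(1), of x] elim R(1) card_image[OF inj] by simp
    qed
    have "\<exists>!y. y \<in> ball y0 e \<and> bipoly_eval F x y = 0" if y0: "y0 \<in> R" for y0
    proof (rule ex1I)
      show "f y0 \<in> ball y0 e \<and> bipoly_eval F x (f y0) = 0" using f[OF y0] .
      fix y assume y: "y \<in> ball y0 e \<and> bipoly_eval F x y = 0"
      then obtain y1 where "y1 \<in> R" "y = f y1" using im by blast
      then show "y = f y0" using same[OF _ y0, of y1 y] f[of y1] y by auto
    qed
    moreover have "{y. bipoly_eval F x y = 0} \<subseteq> (\<Union>y0\<in>R. ball y0 e)"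
      unfolding im[symmetric] using f by blast
    ultimately show ?case using elim(2) by blast
  qed
  then show ?thesis by (rule that[OF e])
qed

section \<open>The curve as a covering space and its lifts\<close>

definition root_curve :: "complex poly poly \<Rightarrow> (complex \<times> complex) set" where
  "root_curve F = {(x, y). x \<in> regular_points F \<and> bipoly_eval F x y = 0}"

text \<open>Over a small disc \<open>T\<close> the curve splits into sheets \<open>U y0\<close>, one
  for each root \<open>y0\<close> at the centre. Each sheet is the graph of the unique root
  \<open>r y0\<close> in the ball around \<open>y0\<close>, hence homeomorphic to \<open>T\<close>
  once \<open>r y0\<close> is continuous.\<close>

lemma covering_space_root_curve:
  assumes deg: "degree F > 0"
  shows "covering_space (root_curve F) fst (regular_points F)"
proof
  show "continuous_on (root_curve F) fst" by (intro continuous_intros)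
  have "\<exists>y. bipoly_eval F x y = 0" if "x \<in> regular_points F" for x
  proof -
    have "{y. bipoly_eval F x y = 0} \<noteq> {}"
      using card_roots(1)[OF deg that] deg by force
    then show ?thesis by blast
  qed
  then show "fst ` root_curve F = regular_points F"
    by (force simp: root_curve_def)
next
  fix x0 assume x0: "x0 \<in> regular_points F"
  define R where "R = {y. bipoly_eval F x0 y = 0}"
  obtain e where e: "e > 0" and disj: "pairwise (\<lambda>y y'. disjnt (ball y e) (ball y' e)) R"
    and ev: "\<forall>\<^sub>F x in nhds x0. x \<in> regular_points F \<and> {y. bipoly_eval F x y = 0} \<subseteq> (\<Union>y0\<in>R. ball y0 e) \<and>
      (\<forall>y0\<in>R. \<exists>!y. y \<in> ball y0 e \<and> bipoly_eval F x y = 0)"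
    using eventually_roots_separated[OF deg x0 R_def] .
  obtain d where "d > 0" and d': "\<forall>x. dist x x0 < d \<longrightarrow> x \<in> regular_points F \<and>
      {y. bipoly_eval F x y = 0} \<subseteq> (\<Union>y0\<in>R. ball y0 e) \<and>
      (\<forall>y0\<in>R. \<exists>!y. y \<in> ball y0 e \<and> bipoly_eval F x y = 0)"
    using ev unfolding eventually_nhds_metric by (elim exE conjE)
  have d1: "x \<in> regular_points F" if "dist x x0 < d" for x
    using d'[rule_format, OF that] by (elim conjE)
  have d2: "{y. bipoly_eval F x y = 0} \<subseteq> (\<Union>y0\<in>R. ball y0 e)" if "dist x x0 < d" for x
    using d'[rule_format, OF that] by (elim conjE)
  have d3: "\<exists>!y. y \<in> ball y0 e \<and> bipoly_eval F x y = 0" if "dist x x0 < d" "y0 \<in> R" for x y0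
    using d'[rule_format, OF that(1)] that(2) by (elim conjE) (rule bspec)
  define T where "T = ball x0 d"
  define U where "U y0 = root_curve F \<inter> (T \<times> ball y0 e)" for y0
  define r where "r y0 x = (THE y. y \<in> ball y0 e \<and> bipoly_eval F x y = 0)" for y0 x
  have TD: "dist x x0 < d" if "x \<in> T" for x using that by (simp add: T_def dist_commute)
  have r: "r y0 x \<in> ball y0 e \<and> bipoly_eval F x (r y0 x) = 0" if "y0 \<in> R" "x \<in> T" for y0 x
    unfolding r_def by (rule theI'[OF d3[OF TD[OF that(2)] that(1)]])
  have r_unique: "y = r y0 x" if "y0 \<in> R" "x \<in> T" "y \<in> ball y0 e" "bipoly_eval F x y = 0" for y0 x y
    using d3[OF TD[OF that(2)] that(1)] r[OF that(1,2)] that(3,4) by blast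
  have cont: "continuous_on T (r y0)" if y0: "y0 \<in> R" for y0
    unfolding continuous_on_iff
  proof (intro ballI allI impI)
    fix x1 and e' :: real assume x1: "x1 \<in> T" and "e' > 0"
    note rx = r[OF y0 x1]
    \<comment> \<open>Near \<open>x1\<close> some root lies within \<open>min s e'\<close> of
      \<open>r y0 x1\<close>. The radius \<open>s\<close> keeps it in the ball around
      \<open>y0\<close>, where uniqueness identifies it with \<open>r y0 x\<close>.\<close>
    obtain s where s: "s > 0" "ball (r y0 x1) s \<subseteq> ball y0 e"
      using rx open_ball openE by blast
    have "\<forall>\<^sub>F x in nhds x1. \<exists>y\<in>ball (r y0 x1) (min s e'). bipoly_eval F x y = 0"
      using eventually_root_near[OF deg, of x1 "r y0 x1" "min s e'"] rx d1[OF TD[OF x1]] s \<open>e' > 0\<close> by simp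
    then obtain t where t: "t > 0" "\<And>x. dist x x1 < t \<Longrightarrow> \<exists>y\<in>ball (r y0 x1) (min s e'). bipoly_eval F x y = 0"
      unfolding eventually_nhds_metric by blast
    have "dist (r y0 x) (r y0 x1) < e'" if xT: "x \<in> T" "dist x x1 < t" for x
    proof -
      obtain y where y: "y \<in> ball (r y0 x1) (min s e')" "bipoly_eval F x y = 0"
        using t(2)[OF xT(2)] by blast
      then have "y \<in> ball y0 e" using s(2) by auto
      then have "y = r y0 x" using r_unique[OF y0 xT(1) _ y(2)] by blast
      then show ?thesis using y(1) by (simp add: dist_commute)
    qed
    then show "\<exists>t>0. \<forall>x\<in>T. dist x x1 < t \<longrightarrow> dist (r y0 x) (r y0 x1) < e'"
      using t(1) by blast
  qed
  have homeo: "homeomorphism (U y0) T fst (\<lambda>x. (x, r y0 x))" if y0: "y0 \<in> R" for y0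
  proof (rule homeomorphismI)
    show "continuous_on (U y0) fst" by (intro continuous_intros)
    show "continuous_on T (\<lambda>x. (x, r y0 x))" by (intro continuous_intros cont y0)
    show "fst ` U y0 \<subseteq> T" by (auto simp: U_def)
    show "(\<lambda>x. (x, r y0 x)) ` T \<subseteq> U y0"
      using r[OF y0] d1[OF TD] by (auto simp: U_def root_curve_def)
    show "(fst p, r y0 (fst p)) = p" if "p \<in> U y0" for p
      using that r_unique[OF y0, of "fst p" "snd p"] by (cases p) (auto simp: U_def root_curve_def)
  qed auto
  show "\<exists>T. x0 \<in> T \<and> openin (top_of_set (regular_points F)) T \<and>
         (\<exists>v. \<Union> v = root_curve F \<inter> fst -` T \<and>
              (\<forall>u\<in>v. openin (top_of_set (root_curve F)) u) \<and>
              pairwise disjnt v \<and> (\<forall>u\<in>v. \<exists>q. homeomorphism u T fst q))"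
  proof (intro exI[of _ T] exI[of _ "U ` R"] conjI)
    show "x0 \<in> T" using \<open>d > 0\<close> by (simp add: T_def)
    show "openin (top_of_set (regular_points F)) T"
      using d1[OF TD] by (intro open_openin_trans) (auto simp: T_def open_regular_points)
    show "\<Union> (U ` R) = root_curve F \<inter> fst -` T"
      using d2[OF TD] by (fastforce simp: U_def root_curve_def)
    show "\<forall>u\<in>U ` R. openin (top_of_set (root_curve F)) u"
      by (simp add: U_def T_def openin_open_Int open_Times)
    show "pairwise disjnt (U ` R)"
    proof (rule pairwise_imageI)
      fix y y' assume "y \<in> R" "y' \<in> R" "y \<noteq> y'"
      then have "disjnt (ball y e) (ball y' e)" using disj by (simp add: pairwise_def)
      then show "disjnt (U y) (U y')" unfolding disjnt_def U_def by blast
    qed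
    show "\<forall>u\<in>U ` R. \<exists>q. homeomorphism u T fst q"
      using homeo by blast
  qed
qed

lemma root_lift:
  fixes f :: "complex \<Rightarrow> complex"
  assumes deg: "degree F > 0" and U: "open U" "simply_connected U"
    and f: "continuous_on U f" "f ` U \<subseteq> regular_points F"
    and u0: "u0 \<in> U" "bipoly_eval F (f u0) y0 = 0"
  obtains g where "continuous_on U g" "g u0 = y0" "\<And>u. u \<in> U \<Longrightarrow> bipoly_eval F (f u) (g u) = 0"
proof -
  have a: "(f u0, y0) \<in> root_curve F" using f u0 by (auto simp: root_curve_def)
  obtain G where G: "continuous_on U G" "G \<in> U \<rightarrow> root_curve F" "G u0 = (f u0, y0)"
    "\<And>u. u \<in> U \<Longrightarrow> fst (G u) = f u"
    by (rule covering_space_lift_strong[OF covering_space_root_curve[OF deg] a u0(1) U(2) _ f(1)])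
      (use U f in \<open>auto intro: open_imp_locally_path_connected\<close>)
  show ?thesis
  proof (rule that[of "snd \<circ> G"])
    show "continuous_on U (snd \<circ> G)" using G(1) by (auto intro!: continuous_intros simp: o_def)
    show "bipoly_eval F (f u) ((snd \<circ> G) u) = 0" if "u \<in> U" for u
      using G(2) G(4)[OF that] that by (cases "G u") (force simp: root_curve_def)
  qed (use G in auto)
qed

text \<open>The domain is a general topological space because the lemma serves both for plane
  regions and for a real half-line, along which a given curve is compared with the restriction of a
  lift.\<close>

lemma root_lift_unique:
  fixes f :: "'a::topological_space \<Rightarrow> complex"
  assumes deg: "degree F > 0" and T: "connected T" "a \<in> T" "u \<in> T"
    and f: "continuous_on T f" "f ` T \<subseteq> regular_points F"
    and g1: "continuous_on T g1" "\<And>u. u \<in> T \<Longrightarrow> bipoly_eval F (f u) (g1 u) = 0"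
    and g2: "continuous_on T g2" "\<And>u. u \<in> T \<Longrightarrow> bipoly_eval F (f u) (g2 u) = 0"
    and eq: "g1 a = g2 a"
  shows "g1 u = g2 u"
proof -
  have "(f u, g1 u) = (f u, g2 u)"
    by (rule covering_space_lift_unique[OF covering_space_root_curve[OF deg], where T=T and a=a and f=f])
      (use T f g1 g2 eq in \<open>auto intro!: continuous_intros simp: root_curve_def\<close>)
  then show ?thesis by simp
qed

text \<open>Continuity improves to differentiability because the roots are simple: with
  \<open>p = (Y - g u1) * q\<close> the value of \<open>q\<close> at \<open>g u1\<close> is that of
  \<open>pderiv p\<close>, hence nonzero, and the equation \<open>F = 0\<close> can be solved for
  the difference quotient of \<open>g\<close>.\<close>

lemma root_lift_holomorphic:
  assumes deg: "degree F > 0" and U: "open U"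
    and f: "f holomorphic_on U" "f ` U \<subseteq> regular_points F"
    and g: "continuous_on U g" "\<And>u. u \<in> U \<Longrightarrow> bipoly_eval F (f u) (g u) = 0"
  shows "g holomorphic_on U"
  unfolding holomorphic_on_open[OF U]
proof
  fix u1 assume u1: "u1 \<in> U"
  define p where "p = fibre_poly F (f u1)"
  have reg: "f u1 \<in> regular_points F" using f u1 by auto
  have "poly p (g u1) = 0" using g(2)[OF u1] by (simp add: p_def poly_fibre_poly)
  then obtain q where q: "p = [:- g u1, 1:] * q"
    using poly_eq_0_iff_dvd by blast
  have "poly (pderiv p) (g u1) \<noteq> 0"
    using rsquarefree_fibre_poly[OF deg reg] \<open>poly p (g u1) = 0\<close>
    unfolding p_def rsquarefree_roots by blast
  moreover have "pderiv p = [:- g u1, 1:] * pderiv q + q"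
    unfolding q pderiv_mult by (simp add: pderiv_pCons)
  ultimately have q0: "poly q (g u1) \<noteq> 0" by simp
  \<comment> \<open>\<open>c i\<close> is the difference quotient of the \<open>i\<close>-th
    coefficient. Near \<open>u1\<close>, \<open>D\<close> is that of \<open>g\<close>, rewritten in
    terms of the convergent \<open>c i\<close> and of \<open>q\<close>.\<close>
  define c where "c i u = (poly (coeff F i) (f u) - poly (coeff F i) (f u1)) / (u - u1)" for i u
  define D where "D u = - (\<Sum>i\<le>degree F. c i u * g u ^ i) / poly q (g u)" for u
  have "\<exists>c'. (c i \<longlongrightarrow> c') (at u1)" for i
  proof -
    have "(\<lambda>u. poly (coeff F i) (f u)) holomorphic_on U"
      using f by (intro holomorphic_intros)
    then obtain c' where "((\<lambda>u. poly (coeff F i) (f u)) has_field_derivative c') (at u1)"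
      using u1 unfolding holomorphic_on_open[OF U] by blast
    then show ?thesis
      unfolding has_field_derivative_iff c_def by (rule exI)
  qed
  then have "\<exists>c'. \<forall>i. (c i \<longlongrightarrow> c' i) (at u1)" by (intro choice allI)
  then obtain c' where c': "\<And>i. (c i \<longlongrightarrow> c' i) (at u1)" by blast
  have gu: "(g \<longlongrightarrow> g u1) (at u1)"
    using g(1) U u1 by (simp add: continuous_on_eq_continuous_at isCont_def)
  have pq: "((\<lambda>u. poly q (g u)) \<longlongrightarrow> poly q (g u1)) (at u1)"
    using gu by (rule tendsto_poly)
  have lim: "(D \<longlongrightarrow> - (\<Sum>i\<le>degree F. c' i * g u1 ^ i) / poly q (g u1)) (at u1)"
    unfolding D_def by (intro tendsto_intros c' gu pq q0)
  have "\<forall>\<^sub>F u in at u1. poly q (g u) \<noteq> 0"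
    using pq q0 by (rule tendsto_imp_eventually_ne)
  moreover have "\<forall>\<^sub>F u in at u1. u \<in> U \<and> u \<noteq> u1"
    by (intro eventually_conj eventually_at_in_open' eventually_neq_at_within U u1)
  ultimately have "\<forall>\<^sub>F u in at u1. D u = (g u - g u1) / (u - u1)"
  proof eventually_elim
    case (elim u)
    have "(\<Sum>i\<le>degree F. (u - u1) * c i u * g u ^ i) =
        (\<Sum>i\<le>degree F. (poly (coeff F i) (f u) - poly (coeff F i) (f u1)) * g u ^ i)"
      using elim by (simp add: c_def)
    then have "bipoly_eval F (f u) (g u) = poly p (g u) + (\<Sum>i\<le>degree F. (u - u1) * c i u * g u ^ i)"
      unfolding p_def poly_fibre_poly bipoly_eval_def
      by (simp add: left_diff_distrib sum_subtractf)
    also have "\<dots> = (g u - g u1) * poly q (g u) + (u - u1) * (\<Sum>i\<le>degree F. c i u * g u ^ i)"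
      by (simp add: q sum_distrib_left mult.assoc left_diff_distrib)
    finally have "(g u - g u1) * poly q (g u) = - ((u - u1) * (\<Sum>i\<le>degree F. c i u * g u ^ i))"
      using g(2)[of u] elim by (simp add: add_eq_0_iff2)
    then show ?case
      unfolding D_def using elim by (subst frac_eq_eq) (simp_all add: mult.commute)
  qed
  with lim have "((\<lambda>u. (g u - g u1) / (u - u1)) \<longlongrightarrow>
      - (\<Sum>i\<le>degree F. c' i * g u1 ^ i) / poly q (g u1)) (at u1)"
    by (rule Lim_transform_eventually)
  then show "\<exists>f'. (g has_field_derivative f') (at u1)"
    unfolding has_field_derivative_iff by blast
qed

section \<open>Puiseux expansions\<close>

text \<open>A Cauchy bound. For \<open>norm y > 1\<close> the equation is solved for its top term
  and divided by \<open>norm y ^ (degree F - 1)\<close>, which dominates all lower powers; for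
  \<open>norm y \<le> 1\<close> the leading coefficient alone is a bound.\<close>

lemma norm_lead_coeff_mult_root_le:
  assumes "bipoly_eval F x y = 0"
  shows "norm (poly (lead_coeff F) x * y) \<le> (\<Sum>i\<le>degree F. norm (poly (coeff F i) x)) "
proof (cases "norm y \<le> 1 \<or> degree F = 0")
  case True
  have "norm (poly (lead_coeff F) x * y) \<le> norm (poly (lead_coeff F) x)"
  proof (cases "norm y \<le> 1")
    case True
    then show ?thesis by (simp add: norm_mult mult_left_le)
  next
    case False
    then have "degree F = 0" using \<open>norm y \<le> 1 \<or> degree F = 0\<close> by simp
    then show ?thesis using assms by (simp add: bipoly_eval_def)
  qed
  also have "\<dots> \<le> (\<Sum>i\<le>degree F. norm (poly (coeff F i) x))"
    by (rule member_le_sum) auto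
  finally show ?thesis .
next
  case False
  then have y: "norm y > 1" and n: "degree F > 0" by auto
  obtain k where k: "degree F = Suc k" using n by (cases "degree F") auto
  have "poly (lead_coeff F) x * y ^ degree F = - (\<Sum>i<degree F. poly (coeff F i) x * y ^ i)"
    using assms unfolding bipoly_eval_def k sum.atMost_Suc lessThan_Suc_atMost
    by (simp add: eq_neg_iff_add_eq_0 add.commute)
  then have "norm (poly (lead_coeff F) x * y ^ degree F) = norm (\<Sum>i<degree F. poly (coeff F i) x * y ^ i)"
    by (simp only: norm_minus_cancel)
  then have "norm (poly (lead_coeff F) x * y) * norm y ^ (degree F - 1) = norm (\<Sum>i<degree F. poly (coeff F i) x * y ^ i)"
    by (simp add: k norm_mult norm_power mult.assoc)
  also have "\<dots> \<le> (\<Sum>i<degree F. norm (poly (coeff F i) x) * norm y ^ (degree F - 1))"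
    using y by (intro sum_norm_le) (auto simp: norm_mult norm_power intro!: mult_left_mono power_increasing)
  also have "\<dots> = (\<Sum>i<degree F. norm (poly (coeff F i) x)) * norm y ^ (degree F - 1)"
    by (simp add: sum_distrib_right)
  finally have "norm (poly (lead_coeff F) x * y) \<le> (\<Sum>i<degree F. norm (poly (coeff F i) x))"
    by (rule mult_right_le_imp_le, intro zero_less_power) (use y in linarith)
  also have "\<dots> \<le> (\<Sum>i\<le>degree F. norm (poly (coeff F i) x))"
    by (rule sum_mono2) auto
  finally show ?thesis .
qed

text \<open>Roots grow at most like a power of the inverse distance to \<open>p\<close>. The
  exponent \<open>M\<close> is the order of \<open>p\<close> as a zero of the leading coefficient;
  the unit number \<open>s\<close> merely rotates \<open>z\<close>.\<close>

lemma root_growth: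
  fixes p s :: complex
  assumes "F \<noteq> 0" "norm s = 1"
  obtains \<rho> M C where "\<rho> > 0"
    "\<And>z y. norm z < \<rho> \<Longrightarrow> bipoly_eval F (p + s * z) y = 0 \<Longrightarrow> norm (z ^ M * y) \<le> C"
proof -
  let ?l = "lead_coeff F"
  have l0: "?l \<noteq> 0" using assms by simp
  define M where "M = order p ?l"
  obtain q where q: "?l = [:- p, 1:] ^ M * q" "\<not> [:- p, 1:] dvd q"
    using order_decomp[OF l0, of p] unfolding M_def by blast
  have qp: "poly q p \<noteq> 0" using q(2) by (simp add: poly_eq_0_iff_dvd)
  let ?S = "\<lambda>z. \<Sum>i\<le>degree F. norm (poly (coeff F i) (p + s * z))"
  have "isCont (\<lambda>z. ?S z / norm (poly q (p + s * z))) 0"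
    using qp by (intro continuous_intros) auto
  then have "((\<lambda>z. ?S z / norm (poly q (p + s * z))) \<longlongrightarrow> ?S 0 / norm (poly q p)) (nhds 0)"
    by (drule_tac isCont_tendsto_nhds) simp
  then have "\<forall>\<^sub>F z in nhds 0. ?S z / norm (poly q (p + s * z)) < ?S 0 / norm (poly q p) + 1"
    by (rule order_tendstoD) simp
  moreover have "isCont (\<lambda>z. poly q (p + s * z)) 0"
    by (intro continuous_intros)
  then have "((\<lambda>z. poly q (p + s * z)) \<longlongrightarrow> poly q p) (nhds 0)"
    by (drule_tac isCont_tendsto_nhds) simp
  then have "\<forall>\<^sub>F z in nhds 0. poly q (p + s * z) \<noteq> 0"
    using qp by (rule tendsto_imp_eventually_ne)
  ultimately have "\<forall>\<^sub>F z in nhds 0. poly q (p + s * z) \<noteq> 0 \<and> ?S z / norm (poly q (p + s * z)) < ?S 0 / norm (poly q p) + 1"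
    by eventually_elim simp
  then obtain \<rho> where \<rho>: "\<rho> > 0" "\<forall>z. dist z 0 < \<rho> \<longrightarrow> poly q (p + s * z) \<noteq> 0 \<and>
      ?S z / norm (poly q (p + s * z)) < ?S 0 / norm (poly q p) + 1"
    unfolding eventually_nhds_metric by (elim exE conjE)
  show ?thesis
  proof (rule that[OF \<rho>(1)])
    fix z y assume z: "norm z < \<rho>" and y: "bipoly_eval F (p + s * z) y = 0"
    have z': "poly q (p + s * z) \<noteq> 0" "?S z / norm (poly q (p + s * z)) < ?S 0 / norm (poly q p) + 1"
      using \<rho>(2)[rule_format, of z] z by (simp_all add: dist_norm)
    have "norm (z ^ M * y) * norm (poly q (p + s * z)) = norm (poly ?l (p + s * z) * y)"
      by (simp add: q(1) norm_mult norm_power poly_power assms(2))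
    also have "\<dots> \<le> ?S z" by (rule norm_lead_coeff_mult_root_le[OF y])
    finally have "norm (z ^ M * y) \<le> ?S z / norm (poly q (p + s * z))"
      using z'(1) by (simp add: field_simps)
    then show "norm (z ^ M * y) \<le> ?S 0 / norm (poly q p) + 1" using z'(2) by simp
  qed
qed

text \<open>The translates coincide at the base point \<open>u0\<close> by the pigeonhole principle,
  and uniqueness of lifts spreads the coincidence over \<open>H\<close>. All integers
  \<open>k\<close> are covered because the principal logarithm can differ from a given one by a
  multiple of either sign.\<close>

lemma exp_lift_period:
  assumes deg: "degree F > 0" 
    and H: "H = {u. Re u < a}"
    and reg: "\<And>u. u \<in> H \<Longrightarrow> p + s * exp u \<in> regular_points F"
    and Y: "continuous_on H Y" "\<And>u. u \<in> H \<Longrightarrow> bipoly_eval F (p + s * exp u) (Y u) = 0"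
  obtains m :: nat where "m > 0"
    "\<And>u (k :: int). u \<in> H \<Longrightarrow> Y (u + of_int k * (2 * pi * \<i> * m)) = Y u"
proof -
  define u0 :: complex where "u0 = of_real (a - 1)"
  have u0: "u0 \<in> H" by (simp add: H u0_def)
  define T where "T k u = u + \<i> * (of_nat k * (of_real pi * 2))" for k :: nat and u :: complex
  have TH: "T k u \<in> H \<longleftrightarrow> u \<in> H" for k u by (simp add: H T_def)
  have expT: "exp (T k u) = exp u" for k u by (simp add: T_def exp_add)
  have T_root: "bipoly_eval F (p + s * exp u) (Y (T j u)) = 0" if "u \<in> H" for j u
    using Y(2)[of "T j u"] that TH expT by simp
  let ?R = "{y. bipoly_eval F (p + s * exp u0) y = 0}"
  note R = card_roots[OF deg reg[OF u0]]
  have "(\<lambda>k. Y (T k u0)) ` {..degree F} \<subseteq> ?R"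
    using T_root[OF u0] by blast
  then have "card ((\<lambda>k. Y (T k u0)) ` {..degree F}) \<le> degree F"
    using card_mono[OF R(2)] R(1) by simp
  then have "\<not> inj_on (\<lambda>k. Y (T k u0)) {..degree F}"
    using pigeonhole[of "\<lambda>k. Y (T k u0)" "{..degree F}"] by simp
  then obtain k l where kl: "k < l" "Y (T k u0) = Y (T l u0)"
    unfolding inj_on_def by (auto elim: linorder_neqE_nat)
  have eq: "Y (T k u) = Y (T l u)" if "u \<in> H" for u
  proof (rule root_lift_unique[OF deg _ u0 that, where f = "\<lambda>u. p + s * exp u"])
    show "connected H" unfolding H by (intro convex_connected convex_halfspace_Re_lt)
    show "continuous_on H (\<lambda>u. p + s * exp u)" by (intro continuous_intros)
    show "(\<lambda>u. p + s * exp u) ` H \<subseteq> regular_points F" using reg by blast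
    have T_cont: "continuous_on H (\<lambda>u. Y (T j u))" for j
      by (rule continuous_on_compose2[OF Y(1)]) (use TH in \<open>auto simp: T_def intro!: continuous_intros\<close>)
    show "continuous_on H (\<lambda>u. Y (T k u))" "continuous_on H (\<lambda>u. Y (T l u))" by (fact T_cont)+
    show "bipoly_eval F (p + s * exp u) (Y (T k u)) = 0" if "u \<in> H" for u by (rule T_root[OF that])
    show "bipoly_eval F (p + s * exp u) (Y (T l u)) = 0" if "u \<in> H" for u by (rule T_root[OF that])
  qed (use kl in auto)
  define m where "m = l - k"
  have per: "Y (u + 2 * pi * \<i> * m) = Y u" if "u \<in> H" for u
  proof -
    have "u - 2 * pi * \<i> * k \<in> H" using that by (simp add: H)
    from eq[OF this] kl(1) show ?thesis by (simp add: T_def m_def of_nat_diff algebra_simps)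
  qed
  have per_nat: "Y (u + of_nat j * (2 * pi * \<i> * m)) = Y u" if "u \<in> H" for u j
  proof (induction j)
    case (Suc j)
    have "u + of_nat j * (2 * pi * \<i> * m) \<in> H" using that by (simp add: H)
    from per[OF this] Suc show ?case by (simp add: algebra_simps)
  qed simp
  show ?thesis
  proof (rule that)
    show "m > 0" using kl by (simp add: m_def)
    show "Y (u + of_int j * (2 * pi * \<i> * m)) = Y u" if "u \<in> H" for u and j :: int
    proof (cases j rule: int_cases2)
      case (nonneg n) then show ?thesis using per_nat[OF that] by simp
    next
      case (nonpos n)
      have "u + of_int j * (2 * pi * \<i> * m) \<in> H" using that by (simp add: H)
      from per_nat[OF this, of n] nonpos show ?thesis by simp
    qed
  qed
qed

text \<open>For \<open>w = exp u\<close> the value \<open>Y (m * u)\<close> depends on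
  \<open>w\<close> only: \<open>u\<close> is determined modulo \<open>2 \<pi> \<i>\<close>, and
  \<open>m\<close> times that is a period. The growth bound leaves at worst a pole at
  \<open>0\<close>, which the factor \<open>w ^ N\<close> removes.\<close>

theorem puiseux:
  fixes p s :: complex and \<phi> :: "real \<Rightarrow> complex"
  assumes deg: "degree F > 0" and s: "norm s = 1" and "\<rho> > 0"
    and reg: "\<And>z. z \<noteq> 0 \<Longrightarrow> norm z < \<rho> \<Longrightarrow> p + s * z \<in> regular_points F"
    and \<phi>: "continuous_on {0<..<\<rho>} \<phi>"
      "\<And>t. 0 < t \<Longrightarrow> t < \<rho> \<Longrightarrow> bipoly_eval F (p + s * of_real t) (\<phi> t) = 0"
  obtains m N :: nat and P r where "m > 0" "r > 0" "r ^ m \<le> \<rho>" "P holomorphic_on ball 0 r"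
    "\<And>t. 0 < t \<Longrightarrow> t < r \<Longrightarrow> of_real t ^ N * \<phi> (t ^ m) = P (of_real t)"
proof -
  from deg have "F \<noteq> 0" by auto
  from root_growth[OF this s] obtain \<rho>' M C where \<rho>': "\<rho>' > 0"
    and C: "\<And>z y. norm z < \<rho>' \<Longrightarrow> bipoly_eval F (p + s * z) y = 0 \<Longrightarrow> norm (z ^ M * y) \<le> C"
    by metis
  \<comment> \<open>With this choice \<open>exp\<close> maps \<open>H\<close> onto the punctured
    disc in which both regularity and the growth bound hold.\<close>
  define a where "a = ln (min \<rho> \<rho>')"
  have ea: "exp a = min \<rho> \<rho>'" using \<open>\<rho> > 0\<close> \<rho>' by (simp add: a_def)
  define H where "H = {u. Re u < a}"
  have H: "open H" "convex H" unfolding H_def by (rule open_halfspace_Re_lt, rule convex_halfspace_Re_lt)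
  have norm_exp: "norm (exp u) < min \<rho> \<rho>'" if "u \<in> H" for u
    using that unfolding norm_exp_eq_Re ea[symmetric] H_def by simp
  have regH: "p + s * exp u \<in> regular_points F" if "u \<in> H" for u
    using reg[of "exp u"] norm_exp[OF that] by simp
  define u0 :: complex where "u0 = of_real (a - 1)"
  have u0: "u0 \<in> H" by (simp add: H_def u0_def)
  have exp_real: "0 < exp x" "exp x < \<rho>" if "x < a" for x
  proof -
    have "exp x < exp a" using that by simp
    then show "exp x < \<rho>" unfolding ea by simp
  qed simp
  have exp_u0: "exp u0 = of_real (exp (a - 1))" by (simp only: u0_def exp_of_real)
  have root_u0: "bipoly_eval F (p + s * exp u0) (\<phi> (exp (a - 1))) = 0"
    unfolding exp_u0 using exp_real[of "a - 1"] by (intro \<phi>(2)) auto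
  have f: "continuous_on H (\<lambda>u. p + s * exp u)" "(\<lambda>u. p + s * exp u) ` H \<subseteq> regular_points F"
    using regH by (auto intro!: continuous_intros)
  obtain Y where Y: "continuous_on H Y" "Y u0 = \<phi> (exp (a - 1))"
      "\<And>u. u \<in> H \<Longrightarrow> bipoly_eval F (p + s * exp u) (Y u) = 0"
    using root_lift[OF deg H(1) convex_imp_simply_connected[OF H(2)] f u0 root_u0] by blast
  have Y_holo: "Y holomorphic_on H"
    by (rule root_lift_holomorphic[OF deg H(1) _ _ Y(1,3)]) (use regH in \<open>auto intro!: holomorphic_intros\<close>)
  \<comment> \<open>Along the real axis both sides lift the path \<open>p + s * exp x\<close>, and
    they share the value at \<open>a - 1\<close>.\<close>
  have Y_real: "Y (of_real x) = \<phi> (exp x)" if "x < a" for x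
  proof (rule root_lift_unique[OF deg, where T = "{..<a}" and a = "a - 1" and f = "\<lambda>x. p + s * of_real (exp x)"
        and ?g1.0 = "\<lambda>x. Y (of_real x)" and ?g2.0 = "\<lambda>x. \<phi> (exp x)"])
    show "connected {..<a}" by (intro convex_connected convex_real_interval)
    show "continuous_on {..<a} (\<lambda>x. p + s * of_real (exp x))" by (intro continuous_intros)
    show "(\<lambda>x. p + s * of_real (exp x)) ` {..<a} \<subseteq> regular_points F"
      using regH[of "of_real _"] by (auto simp: H_def exp_of_real)
    show "continuous_on {..<a} (\<lambda>x. Y (of_real x))"
      by (rule continuous_on_compose2[OF Y(1)]) (auto intro!: continuous_intros simp: H_def)
    show "continuous_on {..<a} (\<lambda>x. \<phi> (exp x))"
      by (rule continuous_on_compose2[OF \<phi>(1)]) (use exp_real in \<open>auto intro!: continuous_intros\<close>)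
    show "bipoly_eval F (p + s * of_real (exp u)) (Y (of_real u)) = 0" if "u \<in> {..<a}" for u
      using Y(3)[of "of_real u"] that by (simp add: H_def exp_of_real)
    show "bipoly_eval F (p + s * of_real (exp u)) (\<phi> (exp u)) = 0" if "u \<in> {..<a}" for u
      using \<phi>(2)[of "exp u"] exp_real[of u] that by simp
    show "Y (of_real (a - 1)) = \<phi> (exp (a - 1))"
      using Y(2) by (simp add: u0_def)
  qed (use that in auto)
  obtain m :: nat where m: "m > 0" and
    per: "\<And>u (k :: int). u \<in> H \<Longrightarrow> Y (u + of_int k * (2 * pi * \<i> * m)) = Y u"
    using exp_lift_period[OF deg H_def regH Y(1,3)] by metis
  \<comment> \<open>For nonzero \<open>w\<close>, \<open>norm w < r\<close> means
    \<open>norm (w ^ m) < exp a\<close>, that is, \<open>m * Ln w \<in> H\<close>.\<close>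
  define r where "r = exp (a / m)"
  have rm: "r ^ m = exp a" using m unfolding r_def exp_of_nat_mult[symmetric] by simp
  have "r > 0" by (simp add: r_def)
  define G where "G w = Y (m * Ln w)" for w
  have in_H: "m * u \<in> H" if "norm (exp u) < r" for u :: complex
  proof -
    have "Re u < a / m" using that by (simp add: r_def norm_exp_eq_Re)
    then show ?thesis using m by (simp add: H_def field_simps)
  qed
  have G_eq: "G (exp u) = Y (m * u)" if "norm (exp u) < r" for u :: complex
  proof -
    have "exp (Ln (exp u)) = exp u" by simp
    then obtain k :: int where k: "Ln (exp u) = u + (of_int (2 * k) * pi) * \<i>"
      unfolding exp_eq by blast
    have "G (exp u) = Y (m * u + of_int k * (2 * pi * \<i> * m))"
      unfolding G_def k by (simp add: algebra_simps)
    then show ?thesis using per[OF in_H[OF that]] by simp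
  qed
  have G_holo: "G holomorphic_on ball 0 r - {0}"
    unfolding analytic_on_open[OF open_delete[OF open_ball], symmetric] analytic_on_holomorphic
  proof -
    have "G analytic_on {w}" if w: "w \<in> ball 0 r - {0}" for w
    proof -
      \<comment> \<open>The disc of radius \<open>norm w\<close> about \<open>w\<close> contains no
        nonpositive real multiple of \<open>w\<close>. On it \<open>Ln (v / w) + Ln w\<close> is a
        holomorphic logarithm of \<open>v\<close>, and periodicity lets it replace
        \<open>Ln v\<close> in \<open>G\<close>, even across the cut of \<open>Ln\<close>.\<close>
      define V where "V = ball w (norm w) \<inter> ball 0 r"
      have V: "open V" "w \<in> V" using w by (auto simp: V_def)
      have div: "v / w \<notin> \<real>\<^sub>\<le>\<^sub>0" if "v \<in> V" for v
      proof
        assume "v / w \<in> \<real>\<^sub>\<le>\<^sub>0"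
        then obtain x where x: "v = of_real x * w" "x \<le> 0"
          using w by (auto elim!: nonpos_Reals_cases simp: field_simps)
        have "norm (w - v) = norm (of_real (1 - x) * w)" by (simp add: x algebra_simps)
        also have "\<dots> = (1 - x) * norm w" using x(2) by (simp only: norm_mult norm_of_real)
        finally have "norm (w - v) = (1 - x) * norm w" .
        moreover have "1 * norm w \<le> (1 - x) * norm w" using x(2) by (intro mult_right_mono) auto
        moreover have "norm (w - v) < norm w" using that by (simp add: V_def dist_norm)
        ultimately show False by simp
      qed
      have expL: "exp (Ln (v / w) + Ln w) = v" if "v \<in> V" for v
      proof -
        have "v \<noteq> 0" using div[OF that] by auto
        then show ?thesis using w by (simp add: exp_add)
      qed
      have "(\<lambda>v. Y (m * (Ln (v / w) + Ln w))) holomorphic_on V"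
      proof (rule holomorphic_on_compose_gen[OF _ Y_holo, unfolded o_def])
        show "(\<lambda>v. m * (Ln (v / w) + Ln w)) holomorphic_on V"
          using div w by (auto intro!: holomorphic_intros)
        show "(\<lambda>v. m * (Ln (v / w) + Ln w)) ` V \<subseteq> H"
        proof (intro image_subsetI in_H)
          fix v assume "v \<in> V"
          then show "norm (exp (Ln (v / w) + Ln w)) < r" by (simp only: expL) (simp add: V_def)
        qed
      qed
      also have "?this \<longleftrightarrow> G holomorphic_on V"
      proof (rule holomorphic_cong)
        fix v assume v: "v \<in> V"
        then show "Y (m * (Ln (v / w) + Ln w)) = G v"
          using G_eq[of "Ln (v / w) + Ln w"] expL[OF v] by (simp add: V_def)
      qed simp
      finally show ?thesis using V analytic_at by blast
    qed
    then have "G analytic_on (ball 0 r - {0})" by (rule iffD2[OF analytic_on_analytic_at, OF ballI])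
    then show "\<exists>T. open T \<and> ball 0 r - {0} \<subseteq> T \<and> G holomorphic_on T"
      unfolding analytic_on_holomorphic .
  qed
  \<comment> \<open>The growth bound is applied at \<open>z = w ^ m\<close>, which turns
    \<open>z ^ M\<close> into \<open>w ^ (m * M)\<close>.\<close>
  have bound: "norm (w ^ (m * M) * G w) \<le> C" if w: "w \<noteq> 0" "norm w < r" for w
  proof -
    have w': "exp (Ln w) = w" using w by simp
    have "exp (m * Ln w) = w ^ m" unfolding exp_of_nat_mult w' ..
    moreover have "m * Ln w \<in> H" using in_H[of "Ln w"] w w' by simp
    ultimately have "norm ((w ^ m) ^ M * G w) \<le> C"
      using C[of "exp (m * Ln w)" "Y (m * Ln w)"] norm_exp[of "m * Ln w"] Y(3)[of "m * Ln w"]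
      by (simp add: G_def)
    then show ?thesis by (simp add: power_mult)
  qed
  \<comment> \<open>One factor more than boundedness requires, so that the limit at \<open>0\<close> exists.\<close>
  define N where "N = Suc (m * M)"
  define P where "P w = (if w = 0 then 0 else w ^ N * G w)" for w
  have "((\<lambda>w. w ^ N * G w) \<longlongrightarrow> 0) (at 0)"
  proof (rule Lim_null_comparison)
    show "\<forall>\<^sub>F w in at 0. norm (w ^ N * G w) \<le> norm w * C"
      unfolding eventually_at
    proof (intro exI[of _ r] conjI ballI impI)
      fix w :: complex assume "w \<noteq> 0 \<and> dist w 0 < r"
      then have "norm (w ^ (m * M) * G w) \<le> C" using bound[of w] by simp
      then have "norm w * norm (w ^ (m * M) * G w) \<le> norm w * C" by (rule mult_left_mono) simp
      then show "norm (w ^ N * G w) \<le> norm w * C" by (simp add: N_def norm_mult mult.assoc)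
    qed (fact \<open>r > 0\<close>)
    have "((\<lambda>w::complex. norm w * C) \<longlongrightarrow> norm (0::complex) * C) (at 0)" by (intro tendsto_intros)
    then show "((\<lambda>w::complex. norm w * C) \<longlongrightarrow> 0) (at 0)" by simp
  qed
  then have "P holomorphic_on ball 0 r"
    unfolding P_def by (intro removable_singularity) (use G_holo in \<open>auto intro!: holomorphic_intros\<close>)
  moreover have "of_real t ^ N * \<phi> (t ^ m) = P (of_real t)" if t: "0 < t" "t < r" for t
  proof -
    have "ln t < ln r" using t by simp
    then have "ln t < a / m" by (simp add: r_def)
    then have l: "m * ln t < a" using m by (simp add: field_simps)
    have "G (of_real t) = Y (of_real (m * ln t))" using t by (simp add: G_def Ln_of_real)
    also have "\<dots> = \<phi> (exp (m * ln t))" using l by (rule Y_real)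
    also have "exp (m * ln t) = t ^ m" using t by (simp add: exp_of_nat_mult)
    finally show ?thesis using t by (simp add: P_def)
  qed
  moreover have "r ^ m \<le> \<rho>" unfolding rm ea by simp
  ultimately show ?thesis using m \<open>r > 0\<close> that by blast
qed

section \<open>Imaginary parts on the real axis and their leading exponent\<close>

text \<open>Used twice: for the order of vanishing at an endpoint and for the identity theorem along
  \<open>I\<close>. The symmetry of \<open>S\<close> lets the reflected function live on the same
  domain.\<close>

lemma reflection_holomorphic:
  assumes "f holomorphic_on S" "open S" "cnj ` S = S"
  shows "(\<lambda>z. f z - cnj (f (cnj z))) holomorphic_on S"
proof -
  have "(\<lambda>z. cnj (f (cnj z))) holomorphic_on S"
    using holomorphic_on_compose_cnj_cnj[of f S] assms by (simp add: o_def)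
  then show ?thesis using assms(1) by (rule holomorphic_on_diff[rotated])
qed

lemma cnj_image_eqI:
  assumes "\<And>z. z \<in> S \<Longrightarrow> cnj z \<in> S"
  shows "cnj ` S = S"
proof
  show "cnj ` S \<subseteq> S" using assms by blast
  show "S \<subseteq> cnj ` S"
  proof
    fix z assume "z \<in> S"
    then have "cnj (cnj z) \<in> cnj ` S" using assms by blast
    then show "z \<in> cnj ` S" by simp
  qed
qed

text \<open>In the variable \<open>t = x powr (1 / m)\<close>, \<open>- Im (\<phi> x)\<close> is
  \<open>t powr (- N)\<close> times a holomorphic function with a zero of some finite order
  \<open>j\<close> at \<open>0\<close>, which gives the exponent \<open>(j - N) / m\<close>. The
  order is finite by \<open>nonzero\<close>; the sign of the limit comes from
  \<open>nonneg\<close>.\<close>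

lemma puiseux_Im_asymptotics:
  fixes p s :: complex and \<phi> :: "real \<Rightarrow> complex"
  assumes deg: "degree F > 0" and s: "norm s = 1" and "\<rho> > 0"
    and reg: "\<And>z. z \<noteq> 0 \<Longrightarrow> norm z < \<rho> \<Longrightarrow> p + s * z \<in> regular_points F"
    and \<phi>: "continuous_on {0<..<\<rho>} \<phi>"
      "\<And>t. 0 < t \<Longrightarrow> t < \<rho> \<Longrightarrow> bipoly_eval F (p + s * of_real t) (\<phi> t) = 0"
    and nonneg: "\<And>t. 0 < t \<Longrightarrow> t < \<rho> \<Longrightarrow> Im (\<phi> t) \<le> 0"
    and nonzero: "\<And>\<epsilon>. 0 < \<epsilon> \<Longrightarrow> \<exists>t. 0 < t \<and> t < \<epsilon> \<and> Im (\<phi> t) \<noteq> 0"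
  obtains \<kappa> L :: real where "\<kappa> \<in> \<rat>" "L > 0"
    "((\<lambda>x. x powr (- \<kappa>) * - Im (\<phi> x)) \<longlongrightarrow> L) (at_right 0)"
proof -
  obtain m N :: nat and P r where m: "m > 0" and r: "r > 0" "r ^ m \<le> \<rho>" and P: "P holomorphic_on ball 0 r"
    and eq: "\<And>t. 0 < t \<Longrightarrow> t < r \<Longrightarrow> of_real t ^ N * \<phi> (t ^ m) = P (of_real t)"
    using puiseux[OF deg s \<open>\<rho> > 0\<close> reg \<phi>] by metis
  \<comment> \<open>\<open>Q\<close> is real on the real axis, where it equals \<open>- Im P\<close>.\<close>
  define Q where "Q z = - (P z - cnj (P (cnj z))) / (2 * \<i>)" for z
  have Q_holo: "Q holomorphic_on ball 0 r"
    unfolding Q_def using reflection_holomorphic[OF P open_ball cnj_image_eqI]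
    by (intro holomorphic_on_divide holomorphic_on_minus holomorphic_on_const) auto
  have Q_real: "Q (of_real t) = of_real (t ^ N * - Im (\<phi> (t ^ m)))" if "0 < t" "t < r" for t
  proof -
    have "Im (P (of_real t)) = t ^ N * Im (\<phi> (t ^ m))"
      unfolding eq[OF that, symmetric] by (simp flip: of_real_power)
    moreover have "Q (of_real t) = of_real (- Im (P (of_real t)))"
      by (simp add: Q_def complex_eq_iff)
    ultimately show ?thesis by simp
  qed
  \<comment> \<open>The \<open>m\<close>-th root of \<open>x1\<close> is a point of the disc at
    which \<open>Q\<close> is nonzero, so \<open>Q\<close> does not vanish identically and has a
    well-defined order at \<open>0\<close>.\<close>
  obtain x1 where x1: "0 < x1" "x1 < r ^ m" "Im (\<phi> x1) \<noteq> 0"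
    using nonzero[of "r ^ m"] r by auto
  define t1 where "t1 = root m x1"
  have t1: "0 < t1" "t1 ^ m = x1" using x1 m by (simp_all add: t1_def)
  moreover have "t1 < r"
    using x1 t1 r by (metis less_le_not_le not_le_imp_less power_mono order_less_imp_le)
  ultimately have "Q (of_real t1) \<noteq> 0" using x1 by (subst Q_real) auto
  then have nz: "\<exists>w\<in>ball 0 r. Q w \<noteq> 0" using t1 \<open>t1 < r\<close> by (intro bexI[of _ "of_real t1"]) auto
  define g j where "g = zor_poly Q 0" and "j = nat (zorder Q 0)"
  have "0 \<in> ball (0::complex) r" using r by simp
  from zorder_exist_zero[OF Q_holo open_ball connected_ball this nz, folded g_def j_def]
  obtain r' where g: "r' > 0" "cball (0::complex) r' \<subseteq> ball 0 r" "g holomorphic_on cball 0 r'"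
    and Qg': "\<forall>w\<in>cball 0 r'. Q w = g w * (w - 0) ^ j \<and> g w \<noteq> 0"
    by (elim conjE exE)
  have Qg: "Q w = g w * w ^ j \<and> g w \<noteq> 0" if "w \<in> cball 0 r'" for w
    using Qg'[rule_format, OF that] by simp
  define r2 where "r2 = min r r'"
  have r2: "r2 > 0" "r2 \<le> r" "r2 \<le> r'" using r g by (auto simp: r2_def)
  have g_real: "g (of_real t) = of_real (t powr (real N - real j) * - Im (\<phi> (t ^ m)))"
    if t: "0 < t" "t < r2" for t
  proof -
    have "g (of_real t) * of_real (t ^ j) = of_real (t ^ N * - Im (\<phi> (t ^ m)))"
      using Qg[of "of_real t"] Q_real[of t] t r2 by simp
    then have "g (of_real t) = of_real (t ^ N * - Im (\<phi> (t ^ m))) / of_real (t ^ j)"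
      using t by (simp add: field_simps)
    also have "\<dots> = of_real (t ^ N / t ^ j * - Im (\<phi> (t ^ m)))" by simp
    also have "t ^ N / t ^ j = t powr (real N - real j)"
      using t by (simp add: powr_diff powr_realpow)
    finally show ?thesis .
  qed
  have "isCont g 0"
    using g by (intro continuous_on_interior[OF holomorphic_on_imp_continuous_on[OF g(3)]]) auto
  then have "(g \<longlongrightarrow> g 0) (at 0)" by (simp add: isCont_def)
  moreover have "filterlim (\<lambda>t. of_real t) (at (0::complex)) (at_right (0::real))"
    unfolding filterlim_at
    by (intro conjI tendsto_eq_intros) (auto simp: eventually_at_right_field intro: exI[of _ 1])
  ultimately have g_lim: "((\<lambda>t. g (of_real t)) \<longlongrightarrow> g 0) (at_right 0)"
    by (rule filterlim_compose)
  have small: "\<forall>\<^sub>F t in at_right 0. 0 < t \<and> t < r2"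
    using r2 by (auto simp: eventually_at_right_field)
  have r2m: "t ^ m < \<rho>" if "0 < t" "t < r2" for t
  proof -
    have "t ^ m < r ^ m" using that m r2 by (intro power_strict_mono) auto
    then show ?thesis using r by simp
  qed
  have ev: "\<forall>\<^sub>F t in at_right 0. Im (g (of_real t)) = 0 \<and> Re (g (of_real t)) \<ge> 0"
    using small
  proof eventually_elim
    case (elim t)
    then show ?case using g_real[of t] nonneg[of "t ^ m"] r2m[of t] by (simp add: mult_nonneg_nonpos)
  qed
  \<comment> \<open>As a nonzero limit of nonnegative reals, \<open>g 0\<close> is a positive real;
    it is the required \<open>L\<close>.\<close>
  have "Im (g 0) = 0"
  proof (rule tendsto_unique[OF trivial_limit_at_right_real])
    show "((\<lambda>t. Im (g (of_real t))) \<longlongrightarrow> Im (g 0)) (at_right 0)" using g_lim by (rule tendsto_Im)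
    show "((\<lambda>t. Im (g (of_real t))) \<longlongrightarrow> 0) (at_right 0)"
      by (rule tendsto_eventually) (use ev in eventually_elim, simp)
  qed
  moreover have "Re (g 0) \<ge> 0"
    by (rule tendsto_lowerbound[OF tendsto_Re[OF g_lim]]) (use ev in eventually_elim, simp_all)
  moreover have "g 0 \<noteq> 0" using Qg[of 0] g by simp
  ultimately have L: "Re (g 0) > 0" by (auto simp: complex_eq_iff less_le)
  \<comment> \<open>Under \<open>t = x powr (1 / m)\<close> the factor \<open>t powr (N - j)\<close>
    becomes \<open>x powr (- \<kappa>)\<close>.\<close>
  define \<kappa> where "\<kappa> = (real j - real N) / real m"
  have "filterlim (\<lambda>x. x powr (1 / m)) (at_right 0) (at_right (0::real))"
    unfolding filterlim_at
  proof
    have "((\<lambda>x. x powr (1 / m)) \<longlongrightarrow> 0 powr (1 / m)) (at_right (0::real))"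
      using m by (intro tendsto_powr') (auto simp: eventually_at_right_field intro!: exI[of _ 1] tendsto_intros)
    then show "((\<lambda>x. x powr (1 / m)) \<longlongrightarrow> 0) (at_right (0::real))" by simp
    show "\<forall>\<^sub>F x in at_right (0::real). x powr (1 / m) \<in> {0<..} \<and> x powr (1 / m) \<noteq> 0"
      by (auto simp: eventually_at_right_field intro!: exI[of _ 1])
  qed
  note sub = this
  have "((\<lambda>x. Re (g (of_real (x powr (1 / m))))) \<longlongrightarrow> Re (g 0)) (at_right 0)"
    by (rule filterlim_compose[OF tendsto_Re[OF g_lim] sub])
  moreover have "\<forall>\<^sub>F x in at_right 0. Re (g (of_real (x powr (1 / m)))) = x powr (- \<kappa>) * - Im (\<phi> x)"
  proof -
    have "\<forall>\<^sub>F x in at_right 0. 0 < x powr (1 / m) \<and> x powr (1 / m) < r2"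
      using sub small by (rule filterlim_iff[THEN iffD1, rule_format])
    moreover have "\<forall>\<^sub>F x in at_right (0::real). 0 < x" by (auto simp: eventually_at_right_field intro!: exI[of _ 1])
    ultimately show ?thesis
    proof eventually_elim
      case (elim x)
      have "(x powr (1 / m)) ^ m = x" using m elim by (simp add: powr_realpow[symmetric] powr_powr)
      then show ?case
        using g_real[of "x powr (1 / m)"] elim m by (simp add: powr_powr \<kappa>_def minus_divide_left)
    qed
  qed
  ultimately have "((\<lambda>x. x powr (- \<kappa>) * - Im (\<phi> x)) \<longlongrightarrow> Re (g 0)) (at_right 0)"
    by (rule Lim_transform_eventually)
  moreover have "\<kappa> \<in> \<rat>" by (simp add: \<kappa>_def)
  ultimately show ?thesis using L that by blast
qed

section \<open>A finite integral bounds the exponent from below\<close>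

lemma nn_integral_inverse_at_0:
  fixes \<delta> :: real
  assumes "\<delta> > 0"
  shows "(\<integral>\<^sup>+x. ennreal (1 / x) * indicator {0<..<\<delta>} x \<partial>lborel) = \<infinity>"
proof (rule ccontr)
  assume "\<not> ?thesis"
  then obtain C where C: "C \<ge> 0" "(\<integral>\<^sup>+x. ennreal (1 / x) * indicator {0<..<\<delta>} x \<partial>lborel) = ennreal C"
    by (metis ennreal_cases infinity_ennreal_def)
  define \<eta> where "\<eta> = \<delta> / 2"
  \<comment> \<open>Chosen so that \<open>ln \<eta> - ln \<epsilon> = C + 1\<close>, one more than
    the supposed total.\<close>
  define \<epsilon> where "\<epsilon> = \<eta> * exp (- (C + 1))"
  have pos: "0 < \<eta>" "\<eta> < \<delta>" "0 < \<epsilon>" "\<epsilon> \<le> \<eta>" using assms C(1) by (auto simp: \<eta>_def \<epsilon>_def)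
  have "(\<integral>\<^sup>+x. ennreal (1 / x) * indicator {\<epsilon>..\<eta>} x \<partial>lborel) = ennreal (ln \<eta> - ln \<epsilon>)"
    by (rule nn_integral_FTC_Icc)
      (use pos in \<open>auto intro!: derivative_eq_intros simp: divide_simps\<close>)
  also have "ln \<eta> - ln \<epsilon> = C + 1" using pos by (simp add: \<epsilon>_def ln_mult)
  finally have "ennreal (C + 1) \<le> ennreal C"
    unfolding C(2)[symmetric] by (elim ssubst[OF sym] ) (use pos in \<open>auto intro!: nn_integral_mono split: split_indicator\<close>)
  then show False using C(1) by simp
qed

text \<open>For \<open>\<kappa> \<le> -1\<close> the function \<open>q\<close> would exceed
  \<open>L / 2 * (1 / x)\<close> near \<open>0\<close>, whose integral diverges.\<close>

lemma powr_integrable_exponent: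
  fixes q :: "real \<Rightarrow> real"
  assumes lim: "((\<lambda>x. x powr (- \<kappa>) * q x) \<longlongrightarrow> L) (at_right 0)" and "L > 0" and "\<delta> > 0"
    and fin: "(\<integral>\<^sup>+x. ennreal (q x) * indicator {0<..<\<delta>} x \<partial>lborel) < \<infinity>"
  shows "\<kappa> > -1"
proof (rule ccontr)
  assume "\<not> ?thesis"
  then have \<kappa>: "\<kappa> \<le> -1" by simp
  have "\<forall>\<^sub>F x in at_right 0. L / 2 < x powr (- \<kappa>) * q x"
    using lim by (rule order_tendstoD) (use \<open>L > 0\<close> in simp)
  then obtain b where b: "b > 0" "\<And>x. 0 < x \<Longrightarrow> x < b \<Longrightarrow> L / 2 < x powr (- \<kappa>) * q x"
    by (auto simp: eventually_at_right_field)
  \<comment> \<open>The bound \<open>1\<close> makes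
    \<open>x powr (-1) \<le> x powr \<kappa>\<close>; the other two keep \<open>x\<close> in the
    range of the limit estimate and of the integral.\<close>
  define c where "c = min (min b 1) \<delta>"
  have c: "c > 0" "c \<le> b" "c \<le> 1" "c \<le> \<delta>" using b \<open>\<delta> > 0\<close> by (auto simp: c_def)
  have le: "L / 2 * (1 / x) \<le> q x" if x: "0 < x" "x < c" for x
  proof -
    have "L / 2 * (1 / x) = L / 2 * x powr (-1)" using x by (simp add: powr_minus_divide)
    also have "\<dots> \<le> L / 2 * x powr \<kappa>"
      using x c \<kappa> \<open>L > 0\<close> by (intro mult_left_mono powr_mono') auto
    also have "\<dots> \<le> x powr (- \<kappa>) * q x * x powr \<kappa>"
      using b(2)[of x] x c by (intro mult_right_mono) auto
    also have "\<dots> = q x" using x by (simp add: powr_minus field_simps)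
    finally show ?thesis .
  qed
  have "ennreal (L / 2) * (\<integral>\<^sup>+x. ennreal (1 / x) * indicator {0<..<c} x \<partial>lborel)
      = (\<integral>\<^sup>+x. ennreal (L / 2) * (ennreal (1 / x) * indicator {0<..<c} x) \<partial>lborel)"
    by (rule nn_integral_cmult[symmetric]) auto
  also have "\<dots> \<le> (\<integral>\<^sup>+x. ennreal (q x) * indicator {0<..<\<delta>} x \<partial>lborel)"
    using le c \<open>L > 0\<close>
    by (intro nn_integral_mono) (auto split: split_indicator simp: ennreal_mult[symmetric] intro!: ennreal_leI)
  finally show False
    using fin nn_integral_inverse_at_0[OF c(1)] \<open>L > 0\<close> by (simp add: ennreal_mult_top)
qed

section \<open>Stieltjes inversion\<close>

lemma norm_inverse_sub_of_real_le:
  assumes "Im z > 0"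
  shows "norm (1 / (z - complex_of_real x)) \<le> 1 / Im z"
proof -
  have "Im z \<le> norm (z - of_real x)" using abs_Im_le_cmod[of "z - of_real x"] assms by simp
  then show ?thesis using assms by (simp add: norm_divide frac_le)
qed

lemma Im_inverse_sub_of_real:
  "- Im (1 / (Complex x \<epsilon> - complex_of_real t)) = \<epsilon> / ((x - t)\<^sup>2 + \<epsilon>\<^sup>2)"
  by (simp add: Im_divide)

lemma nn_integral_Poisson_kernel:
  assumes "\<epsilon> > 0" "\<alpha> \<le> \<beta>"
  shows "(\<integral>\<^sup>+x. ennreal (\<epsilon> / ((x - t)\<^sup>2 + \<epsilon>\<^sup>2)) * indicator {\<alpha>..\<beta>} x \<partial>lborel)
    = ennreal (arctan ((\<beta> - t) / \<epsilon>) - arctan ((\<alpha> - t) / \<epsilon>))"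
proof (rule nn_integral_FTC_Icc)
  show "((\<lambda>x. arctan ((x - t) / \<epsilon>)) has_real_derivative \<epsilon> / ((x - t)\<^sup>2 + \<epsilon>\<^sup>2)) (at x)" for x
  proof -
    have "1 + ((x - t) / \<epsilon>)\<^sup>2 > 0" by (intro add_pos_nonneg) auto
    moreover have "(x - t)\<^sup>2 + \<epsilon>\<^sup>2 > 0" using assms by (intro add_nonneg_pos) auto
    ultimately have "inverse (1 + ((x - t) / \<epsilon>)\<^sup>2) * (1 / \<epsilon>) = \<epsilon> / ((x - t)\<^sup>2 + \<epsilon>\<^sup>2)"
      using assms(1) by (simp add: field_simps power2_eq_square)
    then show ?thesis
      using assms(1) by (auto intro!: derivative_eq_intros)
  qed
qed (use assms in auto)

text \<open>The case \<open>c = 0\<close> is the source of the half weight at the endpoints of an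
  interval in the inversion formula.\<close>

lemma arctan_mult_tendsto:
  "(\<lambda>n. arctan (c * real (Suc n))) \<longlonglongrightarrow> sgn c * (pi / 2)"
proof -
  have lim: "filterlim (\<lambda>n. real (Suc n)) at_top sequentially"
    by (rule filterlim_compose[OF filterlim_real_sequentially filterlim_Suc])
  consider "c > 0" | "c = 0" | "c < 0" by linarith
  then show ?thesis
  proof cases
    case 1
    then have "filterlim (\<lambda>n. c * real (Suc n)) at_top sequentially"
      by (intro filterlim_tendsto_pos_mult_at_top[OF tendsto_const _ lim])
    then show ?thesis using filterlim_compose[OF tendsto_arctan_at_top] 1 by force
  next
    case 3
    then have "filterlim (\<lambda>n. c * real (Suc n)) at_bot sequentially"
      by (intro filterlim_tendsto_neg_mult_at_bot[OF tendsto_const _ lim])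
    then show ?thesis using filterlim_compose[OF tendsto_arctan_at_bot] 3 by force
  qed simp
qed

section \<open>The Stieltjes transform as a Poisson integral\<close>

context real_distribution
begin

lemma integrable_stieltjes:
  assumes "Im z > 0"
  shows "integrable M (\<lambda>x. 1 / (z - complex_of_real x))"
  by (rule integrable_const_bound[where B = "1 / Im z"])
    (use norm_inverse_sub_of_real_le[OF assms] in auto)

text \<open>Continuity is all that uniqueness of lifts asks of the transform.\<close>

lemma isCont_stieltjes:
  assumes "Im z > 0"
  shows "isCont (stieltjes M) z"
proof (rule continuous_at_sequentiallyI)
  fix u assume u: "u \<longlonglongrightarrow> z"
  have "(\<lambda>n. Im (u n)) \<longlonglongrightarrow> Im z" using u by (rule tendsto_Im)
  then have "\<forall>\<^sub>F n in sequentially. Im z / 2 < Im (u n)"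
    by (rule order_tendstoD) (use assms in simp)
  then obtain N where N: "\<And>n. n \<ge> N \<Longrightarrow> Im z / 2 < Im (u n)"
    unfolding eventually_sequentially by blast
  have "(\<lambda>n. stieltjes M (u (n + N))) \<longlonglongrightarrow> stieltjes M z"
    unfolding stieltjes_def
  \<comment> \<open>On the tail the imaginary parts exceed \<open>Im z / 2\<close>, which yields the
    dominating constant.\<close>
  proof (rule integral_dominated_convergence[where w = "\<lambda>_. 2 / Im z"])
    show "AE x in M. (\<lambda>n. 1 / (u (n + N) - of_real x)) \<longlonglongrightarrow> 1 / (z - of_real x)"
    proof (rule AE_I2)
      fix x
      have "z - of_real x \<noteq> 0" using assms by (auto simp: complex_eq_iff)
      then show "(\<lambda>n. 1 / (u (n + N) - of_real x)) \<longlonglongrightarrow> 1 / (z - of_real x)"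
        by (intro tendsto_intros LIMSEQ_ignore_initial_segment u)
    qed
    fix n
    have pos: "Im (u (n + N)) > Im z / 2" by (rule N) simp
    have "norm (1 / (u (n + N) - complex_of_real x)) \<le> 2 / Im z" for x
    proof -
      have "norm (1 / (u (n + N) - complex_of_real x)) \<le> 1 / Im (u (n + N))"
        using pos assms by (intro norm_inverse_sub_of_real_le) simp
      also have "\<dots> \<le> 1 / (Im z / 2)" using pos assms by (intro divide_left_mono) auto
      finally show ?thesis by simp
    qed
    then show "AE x in M. norm (1 / (u (n + N) - complex_of_real x)) \<le> 2 / Im z" by simp
  qed auto
  then show "(\<lambda>n. stieltjes M (u n)) \<longlonglongrightarrow> stieltjes M z" by (rule LIMSEQ_offset)
qed

lemma Im_stieltjes:
  assumes "\<epsilon> > 0"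
  shows "ennreal (- Im (stieltjes M (Complex x \<epsilon>))) = (\<integral>\<^sup>+t. ennreal (\<epsilon> / ((x - t)\<^sup>2 + \<epsilon>\<^sup>2)) \<partial>M)"
    and "- Im (stieltjes M (Complex x \<epsilon>)) \<ge> 0"
proof -
  note int = integrable_stieltjes[of "Complex x \<epsilon>"]
  have int': "integrable M (\<lambda>t. - Im (1 / (Complex x \<epsilon> - complex_of_real t)))"
    using int assms by (intro Bochner_Integration.integrable_minus integrable_Im) simp
  have eq: "- Im (stieltjes M (Complex x \<epsilon>)) = (\<integral>t. - Im (1 / (Complex x \<epsilon> - complex_of_real t)) \<partial>M)"
    unfolding stieltjes_def using int assms by simp
  show "ennreal (- Im (stieltjes M (Complex x \<epsilon>))) = (\<integral>\<^sup>+t. ennreal (\<epsilon> / ((x - t)\<^sup>2 + \<epsilon>\<^sup>2)) \<partial>M)"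
    unfolding eq using int' assms unfolding Im_inverse_sub_of_real
    by (intro nn_integral_eq_integral[symmetric]) (auto intro!: divide_nonneg_nonneg)
  show "- Im (stieltjes M (Complex x \<epsilon>)) \<ge> 0"
    unfolding eq unfolding Im_inverse_sub_of_real using assms by (intro integral_nonneg_AE) auto
qed

text \<open>The Poisson kernel is nonnegative, so the integrals may be exchanged before anything is
  known about integrability; the inner one is a difference of arctangents.\<close>

lemma nn_integral_Im_stieltjes:
  assumes "\<epsilon> > 0" "\<alpha> \<le> \<beta>"
  shows "(\<integral>\<^sup>+x. ennreal (- Im (stieltjes M (Complex x \<epsilon>))) * indicator {\<alpha>..\<beta>} x \<partial>lborel)
    = (\<integral>\<^sup>+t. ennreal (arctan ((\<beta> - t) / \<epsilon>) - arctan ((\<alpha> - t) / \<epsilon>)) \<partial>M)"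
proof -
  interpret P: pair_sigma_finite lborel M ..
  let ?k = "\<lambda>x t. ennreal (\<epsilon> / ((x - t)\<^sup>2 + \<epsilon>\<^sup>2)) * indicator {\<alpha>..\<beta>} x"
  have "(\<integral>\<^sup>+x. ennreal (- Im (stieltjes M (Complex x \<epsilon>))) * indicator {\<alpha>..\<beta>} x \<partial>lborel)
      = (\<integral>\<^sup>+x. (\<integral>\<^sup>+t. ?k x t \<partial>M) \<partial>lborel)"
    unfolding Im_stieltjes(1)[OF assms(1)] by (intro nn_integral_cong nn_integral_multc[symmetric]) simp
  also have "\<dots> = (\<integral>\<^sup>+t. (\<integral>\<^sup>+x. ?k x t \<partial>lborel) \<partial>M)"
    by (rule P.Fubini'[symmetric]) (simp add: split_beta')
  finally show ?thesis unfolding nn_integral_Poisson_kernel[OF assms] .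
qed

text \<open>Both sides are limits of the same integral at heights \<open>\<epsilon> n\<close>.
  Continuity of \<open>y\<close> on a compact rectangle dominates the first form, boundedness of the
  arctangent the second. For \<open>\<alpha> < \<beta>\<close> the weight on the right is
  \<open>pi\<close> inside the interval, \<open>pi / 2\<close> at its endpoints and \<open>0\<close>
  outside.\<close>

lemma stieltjes_inversion:
  assumes "\<alpha> \<le> \<beta>" "\<delta> > 0"
    and y: "continuous_on {z. Re z \<in> {\<alpha>..\<beta>} \<and> Im z \<in> {0..\<delta>}} y"
      "\<And>z. Re z \<in> {\<alpha>..\<beta>} \<Longrightarrow> 0 < Im z \<Longrightarrow> Im z \<le> \<delta> \<Longrightarrow> y z = stieltjes M z"
  shows "(\<integral>\<^sup>+x. ennreal (- Im (y (of_real x))) * indicator {\<alpha>..\<beta>} x \<partial>lborel)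
    = (\<integral>\<^sup>+t. ennreal ((sgn (\<beta> - t) - sgn (\<alpha> - t)) * (pi / 2)) \<partial>M)"
proof -
  let ?D = "{z. Re z \<in> {\<alpha>..\<beta>} \<and> Im z \<in> {0..\<delta>}}"
  define \<epsilon> where "\<epsilon> n = \<delta> / real (Suc n)" for n
  have \<epsilon>: "\<epsilon> n > 0" "\<epsilon> n \<le> \<delta>" for n
    using \<open>\<delta> > 0\<close> by (auto simp: \<epsilon>_def field_simps)
  have \<epsilon>_lim: "\<epsilon> \<longlonglongrightarrow> 0"
    unfolding \<epsilon>_def by (rule LIMSEQ_Suc) (rule lim_const_over_n)
  have "?D = cbox (Complex \<alpha> 0) (Complex \<beta> \<delta>)" by (auto simp: in_cbox_complex_iff)
  then have "compact (y ` ?D)" using y(1) by (metis compact_cbox compact_continuous_image)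
  then obtain C where C: "\<And>z. z \<in> ?D \<Longrightarrow> norm (y z) \<le> C"
    unfolding bounded_iff using compact_imp_bounded bounded_iff by (metis imageI)
  let ?u = "\<lambda>n x. ennreal (- Im (y (Complex x (\<epsilon> n)))) * indicator {\<alpha>..\<beta>} x"
  let ?v = "\<lambda>n t. ennreal (arctan ((\<beta> - t) / \<epsilon> n) - arctan ((\<alpha> - t) / \<epsilon> n))"
  have meas: "(\<lambda>x. ennreal (- Im (y (Complex x e))) * indicator {\<alpha>..\<beta>} x) \<in> borel_measurable lborel"
    if "e \<in> {0..\<delta>}" for e
  proof -
    have "continuous_on {\<alpha>..\<beta>} (\<lambda>x. - Im (y (Complex x e)))"
      by (intro continuous_intros continuous_on_compose2[OF y(1)])
        (use that in \<open>auto simp: Complex_eq intro!: continuous_intros\<close>)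
    then have "(\<lambda>x. indicator {\<alpha>..\<beta>} x *\<^sub>R (- Im (y (Complex x e)))) \<in> borel_measurable borel"
      by (intro borel_measurable_continuous_on_indicator) auto
    then have "(\<lambda>x. ennreal (indicator {\<alpha>..\<beta>} x *\<^sub>R (- Im (y (Complex x e))))) \<in> borel_measurable lborel"
      by simp
    also have "(\<lambda>x. ennreal (indicator {\<alpha>..\<beta>} x *\<^sub>R (- Im (y (Complex x e))))) =
        (\<lambda>x. ennreal (- Im (y (Complex x e))) * indicator {\<alpha>..\<beta>} x)"
      by (auto split: split_indicator)
    finally show ?thesis .
  qed
  have "(\<lambda>n. \<integral>\<^sup>+x. ?u n x \<partial>lborel) \<longlonglongrightarrow>
      (\<integral>\<^sup>+x. ennreal (- Im (y (Complex x 0))) * indicator {\<alpha>..\<beta>} x \<partial>lborel)"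
  proof (rule nn_integral_dominated_convergence[where w = "\<lambda>x. ennreal C * indicator {\<alpha>..\<beta>} x"])
    show "?u n \<in> borel_measurable lborel" for n using meas \<epsilon>[of n] by simp
    show "(\<lambda>x. ennreal (- Im (y (Complex x 0))) * indicator {\<alpha>..\<beta>} x) \<in> borel_measurable lborel"
      using meas[of 0] \<open>\<delta> > 0\<close> by simp
    show "AE x in lborel. ?u n x \<le> ennreal C * indicator {\<alpha>..\<beta>} x" for n
    proof (rule AE_I2)
      fix x
      show "?u n x \<le> ennreal C * indicator {\<alpha>..\<beta>} x"
      proof (cases "x \<in> {\<alpha>..\<beta>}")
        case True
        then have "norm (y (Complex x (\<epsilon> n))) \<le> C" using C \<epsilon>[of n] by simp
        then have "- Im (y (Complex x (\<epsilon> n))) \<le> C"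
          using abs_Im_le_cmod[of "y (Complex x (\<epsilon> n))"] by linarith
        then show ?thesis using True by (simp add: ennreal_leI)
      qed simp
    qed
    show "(\<integral>\<^sup>+x. ennreal C * indicator {\<alpha>..\<beta>} x \<partial>lborel) < \<infinity>"
      by (simp add: nn_integral_cmult ennreal_mult_less_top emeasure_lborel_Icc_eq)
    show "AE x in lborel. (\<lambda>n. ?u n x) \<longlonglongrightarrow> ennreal (- Im (y (Complex x 0))) * indicator {\<alpha>..\<beta>} x"
    proof (rule AE_I2)
      fix x
      show "(\<lambda>n. ?u n x) \<longlonglongrightarrow> ennreal (- Im (y (Complex x 0))) * indicator {\<alpha>..\<beta>} x"
      proof (cases "x \<in> {\<alpha>..\<beta>}")
        case True
        have "(\<lambda>n. Complex x (\<epsilon> n)) \<longlonglongrightarrow> Complex x 0"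
          using \<epsilon>_lim by (intro tendsto_Complex tendsto_const)
        then have "(\<lambda>n. y (Complex x (\<epsilon> n))) \<longlonglongrightarrow> y (Complex x 0)"
          by (rule continuous_on_tendsto_compose[OF y(1)])
            (use True \<epsilon> \<open>\<delta> > 0\<close> in \<open>auto simp: less_imp_le\<close>)
        then show ?thesis using True by (simp add: tendsto_ennrealI tendsto_Im tendsto_minus)
      qed simp
    qed
  qed measurable
  also have "(\<lambda>n. \<integral>\<^sup>+x. ?u n x \<partial>lborel) = (\<lambda>n. \<integral>\<^sup>+t. ?v n t \<partial>M)"
  proof
    fix n
    have "(\<integral>\<^sup>+x. ?u n x \<partial>lborel) = (\<integral>\<^sup>+x. ennreal (- Im (stieltjes M (Complex x (\<epsilon> n)))) * indicator {\<alpha>..\<beta>} x \<partial>lborel)"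
      using y(2)[of "Complex _ (\<epsilon> n)"] \<epsilon>[of n] by (intro nn_integral_cong) (auto split: split_indicator)
    then show "(\<integral>\<^sup>+x. ?u n x \<partial>lborel) = (\<integral>\<^sup>+t. ?v n t \<partial>M)"
      using nn_integral_Im_stieltjes[OF \<epsilon>(1)[of n] \<open>\<alpha> \<le> \<beta>\<close>] by simp
  qed
  finally have lim1: "(\<lambda>n. \<integral>\<^sup>+t. ?v n t \<partial>M) \<longlonglongrightarrow>
      (\<integral>\<^sup>+x. ennreal (- Im (y (Complex x 0))) * indicator {\<alpha>..\<beta>} x \<partial>lborel)" .
  have lim2: "(\<lambda>n. \<integral>\<^sup>+t. ?v n t \<partial>M) \<longlonglongrightarrow>
      (\<integral>\<^sup>+t. ennreal ((sgn (\<beta> - t) - sgn (\<alpha> - t)) * (pi / 2)) \<partial>M)"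
  proof (rule nn_integral_dominated_convergence[where w = "\<lambda>_. ennreal pi"])
    show "AE t in M. ?v n t \<le> ennreal pi" for n
    proof (rule AE_I2)
      fix t
      show "?v n t \<le> ennreal pi"
        using arctan_bounded[of "(\<beta> - t) / \<epsilon> n"] arctan_bounded[of "(\<alpha> - t) / \<epsilon> n"] by (intro ennreal_leI) linarith
    qed
    show "AE t in M. (\<lambda>n. ?v n t) \<longlonglongrightarrow> ennreal ((sgn (\<beta> - t) - sgn (\<alpha> - t)) * (pi / 2))"
    proof (rule AE_I2)
      fix t
      have *: "(\<lambda>n. arctan ((c - t) / \<epsilon> n)) \<longlonglongrightarrow> sgn (c - t) * (pi / 2)" for c
        using arctan_mult_tendsto[of "(c - t) / \<delta>"] \<open>\<delta> > 0\<close> by (simp add: \<epsilon>_def sgn_divide)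
      show "(\<lambda>n. ?v n t) \<longlonglongrightarrow> ennreal ((sgn (\<beta> - t) - sgn (\<alpha> - t)) * (pi / 2))"
        unfolding left_diff_distrib by (intro tendsto_ennrealI tendsto_diff *)
    qed
    show "(\<integral>\<^sup>+t. ennreal pi \<partial>M) < \<infinity>" using emeasure_space_1 by (simp add: space_eq_univ)
  qed auto
  show ?thesis using LIMSEQ_unique[OF lim1 lim2] by (simp add: Complex_eq)
qed
end

section \<open>Identification of the measure with its boundary density\<close>

lemma emeasure_eq_countable_cover:
  assumes sets: "sets M = sets N" and D: "countable D" "D \<subseteq> sets M"
    and eq: "\<And>B X. B \<in> sets M \<Longrightarrow> X \<in> D \<Longrightarrow> emeasure M (B \<inter> X) = emeasure N (B \<inter> X)"
    and B: "B \<in> sets M" "B \<subseteq> \<Union>D"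
  shows "emeasure M B = emeasure N B"
proof (cases "D = {}")
  case True
  then show ?thesis using B by simp
next
  case False
  define A where "A = from_nat_into D"
  have A: "A n \<in> D" for n unfolding A_def by (rule from_nat_into[OF False])
  have UA: "(\<Union>n. A n) = \<Union>D"
    using range_from_nat_into[OF False D(1)] by (simp add: A_def)
  have "A n \<in> sets M" for n using A D(2) by blast
  then have rA: "range A \<subseteq> sets M" by blast
  have dA: "disjointed A n \<in> sets M" for n
    using sets.range_disjointed_sets[OF rA] by blast
  define E where "E n = B \<inter> disjointed A n" for n
  have E: "range E \<subseteq> sets M" using dA B(1) by (auto simp: E_def)
  have dis: "disjoint_family E"
    using disjoint_family_disjointed[of A] by (auto simp: E_def disjoint_family_on_def)
  have UE: "(\<Union>n. E n) = B"
    using B(2) UN_disjointed_eq[of A] UA by (auto simp: E_def)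
  have "emeasure M (E n) = emeasure N (E n)" for n
  proof -
    have "E n = E n \<inter> A n" using disjointed_subset[of A n] by (auto simp: E_def)
    then show ?thesis using eq[of "E n" "A n"] A E by auto
  qed
  then have "(\<Sum>n. emeasure M (E n)) = (\<Sum>n. emeasure N (E n))" by simp
  then show ?thesis
    using suminf_emeasure[OF E dis] suminf_emeasure[of E N] E dis sets UE by simp
qed

lemma continuous_on_strip_axis:
  assumes "\<delta> > 0" "continuous_on {z. Re z \<in> I \<and> \<bar>Im z\<bar> < \<delta>} y"
  shows "continuous_on I (\<lambda>x. y (complex_of_real x))"
  by (rule continuous_on_compose2[OF assms(2)]) (use assms(1) in \<open>auto intro!: continuous_intros\<close>)

text \<open>The sign reflects that the transform has nonpositive imaginary part above the axis. The
  value \<open>0\<close> off \<open>I\<close> makes integrals over the line equal to integrals over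
  \<open>I\<close>.\<close>

definition boundary_density :: "real set \<Rightarrow> (complex \<Rightarrow> complex) \<Rightarrow> real \<Rightarrow> real" where
  "boundary_density I y x = (if x \<in> I then - Im (y (of_real x)) / pi else 0)"

context real_distribution
begin

context
  fixes I :: "real set" and \<delta> :: real and y :: "complex \<Rightarrow> complex"
  assumes I: "open I" "is_interval I" and \<delta>: "\<delta> > 0"
    and y: "continuous_on {z. Re z \<in> I \<and> \<bar>Im z\<bar> < \<delta>} y"
      "\<forall>z. Re z \<in> I \<and> 0 < Im z \<and> Im z < \<delta> \<longrightarrow> y z = stieltjes M z"
begin

lemma boundary_Im_nonpos:
  assumes "x \<in> I"
  shows "Im (y (of_real x)) \<le> 0"
proof -
  \<comment> \<open>Halving keeps even \<open>\<epsilon> 0\<close> strictly below the height at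
    which the open strip ends.\<close>
  define \<epsilon> where "\<epsilon> n = (\<delta> / 2) / real (Suc n)" for n
  have \<epsilon>: "\<epsilon> n > 0" "\<epsilon> n < \<delta>" for n
  proof -
    show "\<epsilon> n > 0" using \<delta> by (simp add: \<epsilon>_def)
    have "\<epsilon> n \<le> \<delta> / 2" using \<delta> by (simp add: \<epsilon>_def field_simps)
    then show "\<epsilon> n < \<delta>" using \<delta> by simp
  qed
  have "\<epsilon> \<longlonglongrightarrow> 0"
    unfolding \<epsilon>_def by (rule LIMSEQ_Suc) (rule lim_const_over_n)
  then have "(\<lambda>n. Complex x (\<epsilon> n)) \<longlonglongrightarrow> Complex x 0"
    by (intro tendsto_Complex tendsto_const)
  then have "(\<lambda>n. y (Complex x (\<epsilon> n))) \<longlonglongrightarrow> y (Complex x 0)"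
    by (rule continuous_on_tendsto_compose[OF y(1)])
      (use assms \<epsilon> \<delta> in \<open>auto simp: abs_of_pos\<close>)
  then have "(\<lambda>n. Im (y (Complex x (\<epsilon> n)))) \<longlonglongrightarrow> Im (y (Complex x 0))" by (rule tendsto_Im)
  moreover have "Im (y (Complex x (\<epsilon> n))) \<le> 0" for n
    using y(2)[rule_format, of "Complex x (\<epsilon> n)"] assms \<epsilon>[of n] Im_stieltjes(2)[of "\<epsilon> n" x] by simp
  ultimately have "Im (y (Complex x 0)) \<le> 0" by (intro LIMSEQ_le_const2) auto
  then show ?thesis by (simp add: Complex_eq)
qed

lemma boundary_integral:
  assumes "\<alpha> \<in> I" "\<beta> \<in> I" "\<alpha> \<le> \<beta>"
  shows "(\<integral>\<^sup>+x. ennreal (- Im (y (of_real x))) * indicator {\<alpha>..\<beta>} x \<partial>lborel)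
    = (\<integral>\<^sup>+t. ennreal ((sgn (\<beta> - t) - sgn (\<alpha> - t)) * (pi / 2)) \<partial>M)"
proof (rule stieltjes_inversion[OF assms(3), of "\<delta> / 2" y])
  have sub: "{\<alpha>..\<beta>} \<subseteq> I"
    using mem_is_interval_1_I[OF I(2) assms(1,2)] by (intro subsetI) simp
  show "\<delta> / 2 > 0" using \<delta> by simp
  show "continuous_on {z. Re z \<in> {\<alpha>..\<beta>} \<and> Im z \<in> {0..\<delta> / 2}} y"
    by (rule continuous_on_subset[OF y(1)]) (use sub \<delta> in auto)
  show "y z = stieltjes M z" if "Re z \<in> {\<alpha>..\<beta>}" "0 < Im z" "Im z \<le> \<delta> / 2" for z
    using that sub \<delta> by (intro y(2)[rule_format]) auto
qed

text \<open>An atom at \<open>c\<close> contributes at least \<open>pi / 2\<close> times its mass to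
  the inversion formula on \<open>{c..c + d}\<close>, already with the half weight of an endpoint,
  while the integral of the bounded boundary values is of order \<open>d\<close>.\<close>

lemma boundary_no_atom:
  assumes c: "c \<in> I"
  shows "{c} \<in> null_sets M"
proof -
  obtain e where e: "e > 0" "cball c e \<subseteq> I" using I(1) c open_contains_cball by blast
  have sub: "{c..c + e} \<subseteq> I" using e by (auto simp: dist_real_def subset_iff)
  have "compact ((\<lambda>x. y (of_real x)) ` {c..c + e})"
    by (rule compact_continuous_image[OF continuous_on_subset[OF continuous_on_strip_axis[OF \<delta> y(1)] sub]]) simp
  then obtain C where C: "\<And>x. x \<in> {c..c + e} \<Longrightarrow> norm (y (of_real x)) \<le> C"
    using compact_imp_bounded bounded_iff by (metis imageI)
  have C0: "C \<ge> 0" using order_trans[OF norm_ge_zero C[of c]] e by simp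
  have le: "measure M {c} * (pi / 2) \<le> C * d" if d: "0 < d" "d \<le> e" for d
  proof -
    have "ennreal (measure M {c} * (pi / 2)) = (\<integral>\<^sup>+t. ennreal (pi / 2) * indicator {c} t \<partial>M)"
      by (subst nn_integral_cmult_indicator) (auto simp: emeasure_eq_measure ennreal_mult[symmetric] mult.commute)
    also have "\<dots> \<le> (\<integral>\<^sup>+t. ennreal ((sgn (c + d - t) - sgn (c - t)) * (pi / 2)) \<partial>M)"
      using d by (intro nn_integral_mono) (auto split: split_indicator)
    also have "\<dots> = (\<integral>\<^sup>+x. ennreal (- Im (y (of_real x))) * indicator {c..c + d} x \<partial>lborel)"
      using c d sub by (intro boundary_integral[symmetric]) auto
    also have "\<dots> \<le> (\<integral>\<^sup>+x. ennreal C * indicator {c..c + d} x \<partial>lborel)"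
    proof (intro nn_integral_mono)
      fix x
      show "ennreal (- Im (y (of_real x))) * indicator {c..c + d} x \<le> ennreal C * indicator {c..c + d} x"
      proof (cases "x \<in> {c..c + d}")
        case True
        then have "norm (y (of_real x)) \<le> C" using C d by auto
        then have "- Im (y (of_real x)) \<le> C"
          using abs_Im_le_cmod[of "y (of_real x)"] by linarith
        then show ?thesis using True by (simp add: ennreal_leI)
      qed simp
    qed
    also have "\<dots> = ennreal (C * d)"
      using d C0 by (simp add: nn_integral_cmult ennreal_mult)
    finally show ?thesis using d C0 by (simp add: ennreal_le_iff)
  qed
  have "measure M {c} = 0"
  proof (rule ccontr)
    assume "measure M {c} \<noteq> 0"
    then have p: "measure M {c} > 0" by (simp add: zero_less_measure_iff)
    \<comment> \<open>Then \<open>C * d\<close> is at most the mass of the atom, whereas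
      \<open>le\<close> makes it at least \<open>pi / 2\<close> times that mass.\<close>
    define d where "d = min e (measure M {c} / (C + 1))"
    have d: "0 < d" "d \<le> e" "d \<le> measure M {c} / (C + 1)" using e p C0 by (auto simp: d_def)
    have "measure M {c} * (pi / 2) \<le> C * d" using le d by simp
    also have "\<dots> \<le> (C + 1) * d" using d by simp
    also have "\<dots> \<le> measure M {c}" using d(3) C0 by (simp add: field_simps)
    finally show False using p pi_gt3 by simp
  qed
  then show ?thesis by (simp add: null_sets_def emeasure_eq_measure)
qed

lemma boundary_density_nonneg: "0 \<le> boundary_density I y x"
  using boundary_Im_nonpos[of x] by (simp add: boundary_density_def divide_nonpos_pos)

lemma boundary_density_measurable [measurable]: "boundary_density I y \<in> borel_measurable borel"
proof -
  have "(\<lambda>x. indicator I x *\<^sub>R (- Im (y (of_real x)) / pi)) \<in> borel_measurable borel"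
    using I(1) by (intro borel_measurable_continuous_on_indicator continuous_intros continuous_on_strip_axis[OF \<delta> y(1)]) auto
  also have "(\<lambda>x. indicator I x *\<^sub>R (- Im (y (of_real x)) / pi)) = boundary_density I y"
    by (auto simp: boundary_density_def fun_eq_iff)
  finally show ?thesis .
qed

text \<open>The endpoints are null, so the sign expression equals \<open>pi\<close> times the
  indicator almost everywhere, and the factor \<open>pi\<close> cancels.\<close>

lemma emeasure_Icc_boundary_density:
  assumes "\<alpha> \<in> I" "\<beta> \<in> I" "\<alpha> \<le> \<beta>"
  shows "emeasure M {\<alpha>..\<beta>} = emeasure (density lborel (\<lambda>x. ennreal (boundary_density I y x))) {\<alpha>..\<beta>}"
proof -
  have sub: "{\<alpha>..\<beta>} \<subseteq> I"
    using mem_is_interval_1_I[OF I(2) assms(1,2)] by (intro subsetI) simp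
  have "AE t in M. ennreal ((sgn (\<beta> - t) - sgn (\<alpha> - t)) * (pi / 2)) = ennreal pi * indicator {\<alpha>..\<beta>} t"
    using AE_not_in[OF boundary_no_atom[OF assms(1)]] AE_not_in[OF boundary_no_atom[OF assms(2)]]
    by eventually_elim (use assms(3) in \<open>auto split: split_indicator simp: sgn_if\<close>)
  then have "(\<integral>\<^sup>+t. ennreal ((sgn (\<beta> - t) - sgn (\<alpha> - t)) * (pi / 2)) \<partial>M)
      = (\<integral>\<^sup>+t. ennreal pi * indicator {\<alpha>..\<beta>} t \<partial>M)"
    by (rule nn_integral_cong_AE)
  also have "\<dots> = ennreal pi * emeasure M {\<alpha>..\<beta>}" by (simp add: nn_integral_cmult)
  finally have "ennreal pi * emeasure M {\<alpha>..\<beta>}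
      = (\<integral>\<^sup>+x. ennreal (- Im (y (of_real x))) * indicator {\<alpha>..\<beta>} x \<partial>lborel)"
    using boundary_integral[OF assms] by simp
  also have "\<dots> = (\<integral>\<^sup>+x. ennreal pi * (ennreal (boundary_density I y x) * indicator {\<alpha>..\<beta>} x) \<partial>lborel)"
  proof (intro nn_integral_cong)
    fix x
    have "ennreal pi * ennreal (boundary_density I y x) = ennreal (- Im (y (of_real x)))" if "x \<in> I"
      using that boundary_density_nonneg[of x] by (simp add: ennreal_mult[symmetric]) (simp add: boundary_density_def)
    then show "ennreal (- Im (y (of_real x))) * indicator {\<alpha>..\<beta>} x
        = ennreal pi * (ennreal (boundary_density I y x) * indicator {\<alpha>..\<beta>} x)"
      using sub by (auto split: split_indicator)
  qed
  also have "\<dots> = ennreal pi * (\<integral>\<^sup>+x. ennreal (boundary_density I y x) * indicator {\<alpha>..\<beta>} x \<partial>lborel)"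
    by (rule nn_integral_cmult) simp
  finally show ?thesis by (simp add: ennreal_mult_cancel_left emeasure_density)
qed

text \<open>\<open>I\<close> is a countable union of compact intervals. On each of them the two
  measures are compared on open half-lines, which cut out either the interval, a shorter compact
  interval without one null endpoint, or nothing.\<close>

lemma emeasure_boundary_density:
  assumes B: "B \<in> sets borel" "B \<subseteq> I"
  shows "emeasure M B = emeasure (density lborel (\<lambda>x. ennreal (boundary_density I y x))) B"
proof -
  let ?N = "density lborel (\<lambda>x. ennreal (boundary_density I y x))"
  obtain D where D: "countable D" "D \<subseteq> Pow I" "\<And>X. X \<in> D \<Longrightarrow> \<exists>a b. X = cbox a b" "\<Union>D = I"
    using open_countable_Union_open_cbox[OF I(1)] by metis
  have D_sets: "D \<subseteq> sets M"
  proof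
    fix X assume "X \<in> D"
    then obtain a b where "X = cbox a b" using D(3) by blast
    then show "X \<in> sets M" by simp
  qed
  have null: "{c} \<in> null_sets ?N" for c
    by (simp add: null_sets_def emeasure_density nn_integral_cmult_indicator)
  show ?thesis
  proof (rule emeasure_eq_countable_cover[OF _ D(1) D_sets])
    fix B X assume B: "B \<in> sets M" and X: "X \<in> D"
    obtain \<alpha> \<beta> where \<alpha>\<beta>: "X = {\<alpha>..\<beta>}" using D(3)[OF X] by auto
    have XI: "{\<alpha>..\<beta>} \<subseteq> I" using X D(2) \<alpha>\<beta> by blast
    \<comment> \<open>Weighting by \<open>indicator X\<close> restricts to \<open>X\<close> but
      keeps a measure on the whole line, where half-lines determine it.\<close>
    have "density M (indicator X) = density ?N (indicator X)"
    proof (rule measure_eqI_lessThan)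
      fix x
      have Xx: "X \<inter> {x<..} = (if x < \<alpha> then {\<alpha>..\<beta>} else {x..\<beta>} - {x})"
        unfolding \<alpha>\<beta> by auto
      have "emeasure M (X \<inter> {x<..}) = emeasure ?N (X \<inter> {x<..})"
      proof (cases "x < \<alpha>")
        case True
        have "emeasure M {\<alpha>..\<beta>} = emeasure ?N {\<alpha>..\<beta>}"
        proof (cases "\<alpha> \<le> \<beta>")
          case True
          then have "\<alpha> \<in> {\<alpha>..\<beta>}" "\<beta> \<in> {\<alpha>..\<beta>}" by auto
          with XI have "\<alpha> \<in> I" "\<beta> \<in> I" by blast+
          then show ?thesis using True by (rule emeasure_Icc_boundary_density)
        qed simp
        then show ?thesis using True unfolding Xx by simp
      next
        case False
        show ?thesis
        proof (cases "x \<le> \<beta>")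
          case True
          then have x: "x \<in> I" "\<beta> \<in> I" using False XI by auto
          have "emeasure M ({x..\<beta>} - {x}) = emeasure M {x..\<beta>}"
            using boundary_no_atom[OF x(1)] by (rule emeasure_Diff_null_set) simp
          moreover have "emeasure ?N ({x..\<beta>} - {x}) = emeasure ?N {x..\<beta>}"
            using null by (rule emeasure_Diff_null_set) simp
          ultimately show ?thesis
            using False emeasure_Icc_boundary_density[OF x True] unfolding Xx by simp
        next
          case False
          then have "X \<inter> {x<..} = {}" unfolding \<alpha>\<beta> by auto
          then show ?thesis by simp
        qed
      qed
      then show "emeasure (density M (indicator X)) {x<..} = emeasure (density ?N (indicator X)) {x<..}"
        by (simp add: emeasure_restricted \<alpha>\<beta>)
      show "emeasure (density M (indicator X)) {x<..} < \<infinity>"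
        by (simp add: emeasure_restricted \<alpha>\<beta> emeasure_eq_measure)
    qed auto
    then have "emeasure (density M (indicator X)) B = emeasure (density ?N (indicator X)) B" by simp
    then show "emeasure M (B \<inter> X) = emeasure ?N (B \<inter> X)"
      using B by (simp add: emeasure_restricted \<alpha>\<beta> Int_commute)
  qed (use B D in auto)
qed

lemma restrict_space_eq_boundary_density:
  "restrict_space M I = density (restrict_space lborel I) (\<lambda>x. ennreal (boundary_density I y x))"
proof (rule measure_eqI)
  have Is: "I \<in> sets borel" using I(1) by simp
  fix A assume "A \<in> sets (restrict_space M I)"
  then have A: "A \<in> sets borel" "A \<subseteq> I"
    using Is by (auto simp: sets_restrict_space)
  have "emeasure (restrict_space M I) A = emeasure M A"
    using A Is by (intro emeasure_restrict_space) auto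
  also have "\<dots> = (\<integral>\<^sup>+x. ennreal (boundary_density I y x) * indicator A x \<partial>lborel)"
    using emeasure_boundary_density[OF A] A by (simp add: emeasure_density)
  also have "\<dots> = (\<integral>\<^sup>+x. ennreal (boundary_density I y x) * indicator A x * indicator I x \<partial>lborel)"
    using A by (intro nn_integral_cong) (auto split: split_indicator)
  also have "\<dots> = (\<integral>\<^sup>+x. ennreal (boundary_density I y x) * indicator A x \<partial>restrict_space lborel I)"
    using Is by (subst nn_integral_restrict_space) auto
  also have "\<dots> = emeasure (density (restrict_space lborel I) (\<lambda>x. ennreal (boundary_density I y x))) A"
    using A Is by (intro emeasure_density[symmetric] measurable_restrict_space1) (auto simp: sets_restrict_space)
  finally show "emeasure (restrict_space M I) A
      = emeasure (density (restrict_space lborel I) (\<lambda>x. ennreal (boundary_density I y x))) A" .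
qed (simp add: sets_restrict_space)

end
end

section \<open>Components of the complement of the discriminant locus\<close>

lemma finite_nonregular_points:
  assumes "F \<noteq> 0" "discriminant F \<noteq> 0"
  shows "finite (- regular_points F)"
proof -
  have "lead_coeff F * discriminant F \<noteq> 0" using assms by simp
  then have "finite {x. poly (lead_coeff F * discriminant F) x = 0}" by (rule poly_roots_finite)
  moreover have "- regular_points F = {x. poly (lead_coeff F * discriminant F) x = 0}"
    by (auto simp: regular_points_def)
  ultimately show ?thesis by simp
qed

text \<open>Real nonregular points avoid \<open>I\<close> by assumption, and the finitely many
  others have a positive least distance from the axis.\<close>

lemma regular_strip:
  assumes "finite (- regular_points F)" "\<And>x. x \<in> I \<Longrightarrow> complex_of_real x \<in> regular_points F"
  obtains \<delta> where "\<delta> > 0" "{z. Re z \<in> I \<and> \<bar>Im z\<bar> < \<delta>} \<subseteq> regular_points F"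
proof -
  \<comment> \<open>The inserted \<open>1\<close> keeps the minimum defined when all nonregular
    points are real.\<close>
  let ?D = "insert 1 ((\<lambda>z. \<bar>Im z\<bar>) ` {z \<in> - regular_points F. Im z \<noteq> 0})"
  have "finite {z \<in> - regular_points F. Im z \<noteq> 0}"
    using assms(1) by (rule rev_finite_subset) blast
  then have fin: "finite ?D" by simp
  show ?thesis
  proof (rule that)
    show "Min ?D > 0" using fin by (subst Min_gr_iff) auto
    show "{z. Re z \<in> I \<and> \<bar>Im z\<bar> < Min ?D} \<subseteq> regular_points F"
    proof (rule subsetI, rule ccontr)
      fix z assume z: "z \<in> {z. Re z \<in> I \<and> \<bar>Im z\<bar> < Min ?D}" and A: "z \<notin> regular_points F"
      show False
      proof (cases "Im z = 0")
        case True
        then have "z = of_real (Re z)" by (simp add: complex_eq_iff)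
        then show False using assms(2)[of "Re z"] z A by simp
      next
        case False
        then have "Min ?D \<le> \<bar>Im z\<bar>" using fin A by (intro Min_le) auto
        then show False using z by simp
      qed
    qed
  qed
qed

text \<open>The centre is left out because \<open>p\<close> will be an endpoint of \<open>I\<close>,
  where the leading coefficient or the discriminant may vanish.\<close>

lemma regular_punctured_ball:
  assumes "finite (- regular_points F)" "norm s = 1"
  obtains \<rho> where "\<rho> > 0" "\<And>z. z \<noteq> 0 \<Longrightarrow> norm z < \<rho> \<Longrightarrow> p + s * z \<in> regular_points F"
proof -
  obtain \<rho> where \<rho>: "\<rho> > 0" "\<And>x. x \<in> - regular_points F \<Longrightarrow> x \<noteq> p \<Longrightarrow> \<rho> \<le> dist p x"
    using finite_set_avoid[OF assms(1), of p] by metis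
  show ?thesis
  proof (rule that[OF \<rho>(1)])
    fix z :: complex assume z: "z \<noteq> 0" "norm z < \<rho>"
    have "s \<noteq> 0" using assms(2) by auto
    then have "p + s * z \<noteq> p" "dist p (p + s * z) < \<rho>"
      using z assms(2) by (simp_all add: dist_norm norm_mult)
    then show "p + s * z \<in> regular_points F" using \<rho>(2)[of "p + s * z"] by auto
  qed
qed

text \<open>In degree 0 the variable \<open>Y\<close> disappears and a nonzero polynomial in
  \<open>X\<close> would have infinitely many zeroes. Applied to the upper half-plane, this supplies
  the positive degree on which the covering rests.\<close>

lemma degree_pos_of_roots:
  assumes "F \<noteq> 0" "infinite X" "\<And>x. x \<in> X \<Longrightarrow> bipoly_eval F x (f x) = 0"
  shows "degree F > 0"
proof (rule ccontr)
  assume "\<not> ?thesis"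
  then have d: "degree F = 0" by simp
  have "coeff F 0 \<noteq> 0" using assms(1) d by (metis leading_coeff_0_iff)
  then have "finite {x. poly (coeff F 0) x = 0}" by (rule poly_roots_finite)
  moreover have "X \<subseteq> {x. poly (coeff F 0) x = 0}"
    using assms(3) d by (auto simp: bipoly_eval_def)
  ultimately show False using assms(2) finite_subset by blast
qed

section \<open>Continuation of the transform across a component\<close>

lemma strip_open_convex:
  assumes "open I" "is_interval I"
  shows "open {z. Re z \<in> I \<and> \<bar>Im z\<bar> < \<delta>}" "convex {z. Re z \<in> I \<and> \<bar>Im z\<bar> < \<delta>}"
    "convex {z. Re z \<in> I \<and> 0 < Im z \<and> Im z < \<delta>}"
proof -
  have cI: "convex I" using assms(2) is_interval_convex by blast
  have lin: "linear Re" "linear Im" by (simp_all add: bounded_linear.linear bounded_linear_Re bounded_linear_Im)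
  have eq: "{z. Re z \<in> I \<and> \<bar>Im z\<bar> < \<delta>} = Re -` I \<inter> Im -` {-\<delta><..<\<delta>}"
    "{z. Re z \<in> I \<and> 0 < Im z \<and> Im z < \<delta>} = Re -` I \<inter> Im -` {0<..<\<delta>}"
    by auto
  show "open {z. Re z \<in> I \<and> \<bar>Im z\<bar> < \<delta>}"
    unfolding eq by (intro open_Int open_vimage assms(1)) (auto intro: continuous_intros)
  show "convex {z. Re z \<in> I \<and> \<bar>Im z\<bar> < \<delta>}" "convex {z. Re z \<in> I \<and> 0 < Im z \<and> Im z < \<delta>}"
    unfolding eq by (intro convex_Int convex_linear_vimage lin cI convex_real_interval)+
qed

lemma (in real_distribution) stieltjes_lift_strip:
  assumes deg: "degree F > 0" and I: "open I" "is_interval I" "I \<noteq> {}" and "\<delta> > 0"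
    and reg: "{z. Re z \<in> I \<and> \<bar>Im z\<bar> < \<delta>} \<subseteq> regular_points F"
    and root: "\<And>z. Im z > 0 \<Longrightarrow> bipoly_eval F z (stieltjes M z) = 0"
  obtains y where "y holomorphic_on {z. Re z \<in> I \<and> \<bar>Im z\<bar> < \<delta>}"
    "\<forall>z. Re z \<in> I \<and> \<bar>Im z\<bar> < \<delta> \<longrightarrow> bipoly_eval F z (y z) = 0"
    "\<forall>z. Re z \<in> I \<and> 0 < Im z \<and> Im z < \<delta> \<longrightarrow> y z = stieltjes M z"
proof -
  let ?R = "{z. Re z \<in> I \<and> \<bar>Im z\<bar> < \<delta>}" and ?U = "{z. Re z \<in> I \<and> 0 < Im z \<and> Im z < \<delta>}"
  note strip = strip_open_convex[OF I(1,2), of \<delta>]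
  obtain x0 where x0: "x0 \<in> I" using I(3) by blast
  \<comment> \<open>Any point of the upper half of the strip would do; the transform at this point
    selects the sheet for \<open>y\<close>.\<close>
  define z0 where "z0 = Complex x0 (\<delta> / 2)"
  have z0: "z0 \<in> ?R" "z0 \<in> ?U" "Im z0 > 0" using x0 \<open>\<delta> > 0\<close> by (simp_all add: z0_def)
  have U_sub: "?U \<subseteq> ?R" by auto
  obtain y where y: "continuous_on ?R y" "y z0 = stieltjes M z0"
      "\<And>z. z \<in> ?R \<Longrightarrow> bipoly_eval F z (y z) = 0"
    using root_lift[OF deg strip(1) convex_imp_simply_connected[OF strip(2)], of "\<lambda>z. z" z0 "stieltjes M z0"]
      reg z0 root[OF z0(3)] by auto
  show ?thesis
  proof (rule that)
    show "y holomorphic_on ?R"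
      by (rule root_lift_holomorphic[OF deg strip(1), where f = "\<lambda>z. z"]) (use reg y in auto)
    show "\<forall>z. Re z \<in> I \<and> \<bar>Im z\<bar> < \<delta> \<longrightarrow> bipoly_eval F z (y z) = 0"
      using y(3) by simp
    have "y z = stieltjes M z" if "z \<in> ?U" for z
    proof (rule root_lift_unique[OF deg, where T = ?U and a = z0 and f = "\<lambda>z. z"
          and ?g1.0 = y and ?g2.0 = "stieltjes M"])
      show "connected ?U" by (rule convex_connected[OF strip(3)])
      show "continuous_on ?U y" by (rule continuous_on_subset[OF y(1) U_sub])
      show "continuous_on ?U (stieltjes M)"
        by (intro continuous_at_imp_continuous_on ballI isCont_stieltjes) simp
      show "(\<lambda>z. z) ` ?U \<subseteq> regular_points F" using U_sub reg by auto
      show "bipoly_eval F u (y u) = 0" if "u \<in> ?U" for u using y(3) U_sub that by blast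
      show "bipoly_eval F u (stieltjes M u) = 0" if "u \<in> ?U" for u using root that by simp
    qed (use that z0 y in auto)
    then show "\<forall>z. Re z \<in> I \<and> 0 < Im z \<and> Im z < \<delta> \<longrightarrow> y z = stieltjes M z" by blast
  qed
qed

section \<open>Analyticity of the density and its behaviour at an endpoint\<close>

text \<open>In the Taylor series of \<open>y\<close> at a real centre, evaluated at a real point,
  the powers are real, so imaginary parts can be taken coefficientwise.\<close>

lemma boundary_density_analytic:
  assumes I: "open I" and "\<delta> > 0" and y: "y holomorphic_on {z. Re z \<in> I \<and> \<bar>Im z\<bar> < \<delta>}"
  shows "real_analytic_on (boundary_density I y) I"
  unfolding real_analytic_on_def
proof
  fix x0 assume x0: "x0 \<in> I"
  obtain e where e: "e > 0" "ball x0 e \<subseteq> I" using I x0 openE by blast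
  define r where "r = min e \<delta>"
  have r: "r > 0" "r \<le> e" "r \<le> \<delta>" using e \<open>\<delta> > 0\<close> by (auto simp: r_def)
  have "ball (of_real x0) r \<subseteq> {z. Re z \<in> I \<and> \<bar>Im z\<bar> < \<delta>}"
  proof
    fix z assume "z \<in> ball (complex_of_real x0) r"
    then have n: "norm (of_real x0 - z) < r" by (simp add: dist_norm)
    have "\<bar>x0 - Re z\<bar> < r" using abs_Re_le_cmod[of "of_real x0 - z"] n by simp
    then have "Re z \<in> ball x0 e" using r by (simp add: dist_real_def)
    moreover have "\<bar>Im z\<bar> < r" using abs_Im_le_cmod[of "of_real x0 - z"] n by simp
    ultimately show "z \<in> {z. Re z \<in> I \<and> \<bar>Im z\<bar> < \<delta>}" using e(2) r by auto
  qed
  then have holo: "y holomorphic_on ball (of_real x0) r" by (rule holomorphic_on_subset[OF y])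
  define c where "c n = - Im ((deriv ^^ n) y (of_real x0) / fact n) / pi" for n
  have "(\<lambda>n. c n * (x - x0) ^ n) sums boundary_density I y x" if x: "x \<in> ball x0 r" for x
  proof -
    have "x \<in> I" using x e(2) r by auto
    have "complex_of_real x \<in> ball (of_real x0) r"
      using x by (simp add: dist_of_real)
    from sums_Im[OF holomorphic_power_series[OF holo this]]
    have "(\<lambda>n. Im ((deriv ^^ n) y (of_real x0) / fact n * (of_real x - of_real x0) ^ n)) sums Im (y (of_real x))" .
    moreover have "Im (a * (of_real x - of_real x0) ^ n) = Im a * (x - x0) ^ n" for a n
      by (simp flip: of_real_diff of_real_power)
    ultimately have "(\<lambda>n. Im ((deriv ^^ n) y (of_real x0) / fact n) * (x - x0) ^ n) sums Im (y (of_real x))"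
      by (simp only:)
    from sums_divide[OF sums_minus[OF this], of pi] show ?thesis
      using \<open>x \<in> I\<close> by (simp add: boundary_density_def c_def)
  qed
  then show "\<exists>r>0. \<exists>c. \<forall>x\<in>ball x0 r. (\<lambda>n. c n * (x - x0) ^ n) sums boundary_density I y x"
    using r(1) by blast
qed

text \<open>The identity theorem is applied to the reflected difference of \<open>y\<close> on the
  connected strip: it vanishes on \<open>{u<..<v}\<close>, hence at every point of \<open>I\<close>,
  where it is a multiple of the density.\<close>

lemma boundary_density_zero:
  assumes I: "open I" "is_interval I" and "\<delta> > 0" and y: "y holomorphic_on {z. Re z \<in> I \<and> \<bar>Im z\<bar> < \<delta>}"
    and J: "u < v" "{u<..<v} \<subseteq> I" "\<And>x. x \<in> {u<..<v} \<Longrightarrow> boundary_density I y x = 0"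
  shows "boundary_density I y x = 0"
proof (cases "x \<in> I")
  case True
  let ?R = "{z. Re z \<in> I \<and> \<bar>Im z\<bar> < \<delta>}"
  note strip = strip_open_convex[OF I, of \<delta>]
  have "cnj ` ?R = ?R" by (rule cnj_image_eqI) simp
  then have holo: "(\<lambda>z. y z - cnj (y (cnj z))) holomorphic_on ?R"
    by (rule reflection_holomorphic[OF y strip(1)])
  define w where "w = (u + v) / 2"
  have w: "w \<in> {u<..<v}" using J(1) by (simp add: w_def field_simps)
  have "w islimpt {u<..<v}"
    using w by (simp add: islimpt_greaterThanLessThan1 interior_limit_point)
  have lp: "complex_of_real w islimpt complex_of_real ` {u<..<v}"
    unfolding islimpt_approachable
  proof (intro allI impI)
    fix e :: real assume "e > 0"
    with \<open>w islimpt {u<..<v}\<close> obtain t where "t \<in> {u<..<v}" "t \<noteq> w" "dist t w < e"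
      unfolding islimpt_approachable by blast
    then show "\<exists>x'\<in>complex_of_real ` {u<..<v}. x' \<noteq> of_real w \<and> dist x' (of_real w) < e"
      by (intro bexI[of _ "of_real t"]) (auto simp: dist_of_real)
  qed
  have "y (of_real x) - cnj (y (cnj (of_real x))) = 0"
  proof (rule analytic_continuation[OF holo strip(1) convex_connected[OF strip(2)] _ _ lp])
    show "of_real ` {u<..<v} \<subseteq> ?R" using J(2) \<open>\<delta> > 0\<close> by auto
    show "of_real w \<in> ?R" using J(2) w \<open>\<delta> > 0\<close> by auto
    show "of_real x \<in> ?R" using True \<open>\<delta> > 0\<close> by simp
    fix z assume "z \<in> complex_of_real ` {u<..<v}"
    then obtain t where t: "t \<in> {u<..<v}" "z = of_real t" by (elim imageE)
    have "t \<in> I" using J(2) t(1) by (rule subsetD)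
    then have "Im (y z) = 0" using J(3)[OF t(1)] by (simp add: boundary_density_def t(2))
    then show "y z - cnj (y (cnj z)) = 0" by (simp add: t(2) complex_eq_iff)
  qed
  then have "Im (y (of_real x)) = 0" by (simp add: complex_eq_iff)
  then show ?thesis by (simp add: boundary_density_def)
qed (simp add: boundary_density_def)

text \<open>The sign \<open>e\<close> treats left and right endpoints together:
  \<open>p + e * t\<close> moves into \<open>I\<close> as \<open>t\<close> grows from
  \<open>0\<close>. With \<open>c = 1 + \<kappa>\<close> the claim \<open>c > 0\<close> is
  integrability of the density.\<close>

lemma (in real_distribution) boundary_density_edge:
  fixes p e :: real
  assumes deg: "degree F > 0" and fin: "finite (- regular_points F)"
    and I: "open I" "is_interval I" and \<delta>: "\<delta> > 0"
    and y: "y holomorphic_on {z. Re z \<in> I \<and> \<bar>Im z\<bar> < \<delta>}"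
      "\<forall>z. Re z \<in> I \<and> \<bar>Im z\<bar> < \<delta> \<longrightarrow> bipoly_eval F z (y z) = 0"
      "\<forall>z. Re z \<in> I \<and> 0 < Im z \<and> Im z < \<delta> \<longrightarrow> y z = stieltjes M z"
    and e: "e = 1 \<or> e = - 1" and \<rho>: "\<rho> > 0" "\<And>t. 0 < t \<Longrightarrow> t < \<rho> \<Longrightarrow> p + e * t \<in> I"
    and nonzero: "boundary_density I y x0 \<noteq> 0"
  obtains c L where "c \<in> \<rat>" "c > 0" "L > 0"
    "((\<lambda>t. t powr (1 - c) * boundary_density I y (p + e * t)) \<longlongrightarrow> L) (at_right 0)"
proof -
  let ?h = "boundary_density I y"
  note cont = holomorphic_on_imp_continuous_on[OF y(1)]
  note bd = boundary_Im_nonpos[OF I \<delta> cont y(3)] boundary_density_nonneg[OF I \<delta> cont y(3)]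
    boundary_density_measurable[OF I \<delta> cont y(3)] emeasure_boundary_density[OF I \<delta> cont y(3)]
    continuous_on_strip_axis[OF \<delta> cont]
  have norm_e: "norm (complex_of_real e) = 1" using e by auto
  obtain \<rho>1 where \<rho>1: "\<rho>1 > 0" "\<And>z. z \<noteq> 0 \<Longrightarrow> norm z < \<rho>1 \<Longrightarrow> of_real p + of_real e * z \<in> regular_points F"
    using regular_punctured_ball[OF fin norm_e, of "of_real p"] by metis
  define r where "r = min \<rho> \<rho>1"
  have r: "r > 0" "r \<le> \<rho>" "r \<le> \<rho>1" using \<rho> \<rho>1 by (auto simp: r_def)
  define \<phi> where "\<phi> t = y (of_real (p + e * t))" for t
  have inI: "p + e * t \<in> I" if "0 < t" "t < r" for t using \<rho>(2) that r by simp
  have h\<phi>: "?h (p + e * t) = - Im (\<phi> t) / pi" if "0 < t" "t < r" for t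
    using inI[OF that] by (simp add: boundary_density_def \<phi>_def)
  \<comment> \<open>If the imaginary part vanished on a one-sided neighbourhood of \<open>p\<close>,
    the identity theorem would make the density vanish on all of \<open>I\<close>, against
    \<open>nonzero\<close>.\<close>
  have nz: "\<exists>t. 0 < t \<and> t < \<epsilon> \<and> Im (\<phi> t) \<noteq> 0" if "\<epsilon> > 0" for \<epsilon>
  proof (rule ccontr)
    assume "\<not> ?thesis"
    then have zero: "Im (\<phi> t) = 0" if "0 < t" "t < \<epsilon>" for t using that by blast
    define d where "d = min \<epsilon> r"
    have d: "d > 0" "d \<le> \<epsilon>" "d \<le> r" using \<open>\<epsilon> > 0\<close> r by (auto simp: d_def)
    define u v where "u = (if e = 1 then p else p - d)" and "v = (if e = 1 then p + d else p)"
    have uv: "\<exists>t. 0 < t \<and> t < d \<and> x = p + e * t" if "x \<in> {u<..<v}" for x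
      using e that by (intro exI[of _ "e * (x - p)"]) (auto simp: u_def v_def)
    have "u < v" using d by (simp add: u_def v_def)
    moreover have "{u<..<v} \<subseteq> I"
    proof
      fix x assume "x \<in> {u<..<v}"
      then obtain t where "0 < t" "t < d" "x = p + e * t" using uv by blast
      then show "x \<in> I" using inI d by simp
    qed
    moreover have "?h x = 0" if xuv: "x \<in> {u<..<v}" for x
    proof -
      obtain t where "0 < t" "t < d" "x = p + e * t" using uv[OF xuv] by blast
      then show ?thesis using h\<phi>[of t] zero[of t] d by simp
    qed
    ultimately have "?h x0 = 0" by (rule boundary_density_zero[OF I \<delta> y(1)])
    with nonzero show False by simp
  qed
  obtain \<kappa> L where \<kappa>: "\<kappa> \<in> \<rat>" "L > 0" and lim: "((\<lambda>t. t powr (- \<kappa>) * - Im (\<phi> t)) \<longlongrightarrow> L) (at_right 0)"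
  proof (rule puiseux_Im_asymptotics[OF deg norm_e r(1), of "of_real p" \<phi>])
    show "of_real p + of_real e * z \<in> regular_points F" if "z \<noteq> 0" "norm z < r" for z
      using \<rho>1(2) that r by simp
    show "continuous_on {0<..<r} \<phi>"
      unfolding \<phi>_def by (rule continuous_on_compose2[OF bd(5)]) (auto intro!: continuous_intros inI)
    show "bipoly_eval F (of_real p + of_real e * of_real t) (\<phi> t) = 0" if "0 < t" "t < r" for t
      using y(2)[rule_format, of "of_real (p + e * t)"] inI[OF that] \<delta> by (simp add: \<phi>_def)
    show "Im (\<phi> t) \<le> 0" if "0 < t" "t < r" for t
      using bd(1)[OF inI[OF that]] by (simp add: \<phi>_def)
    show "\<exists>t>0. t < \<epsilon> \<and> Im (\<phi> t) \<noteq> 0" if "0 < \<epsilon>" for \<epsilon>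
      by (rule nz[OF that])
  qed (rule that)
  have lim': "((\<lambda>t. t powr (- \<kappa>) * ?h (p + e * t)) \<longlongrightarrow> L / pi) (at_right 0)"
  proof (rule Lim_transform_eventually)
    show "((\<lambda>t. t powr (- \<kappa>) * - Im (\<phi> t) / pi) \<longlongrightarrow> L / pi) (at_right 0)"
      by (intro tendsto_divide lim tendsto_const) simp
    have "\<forall>\<^sub>F t in at_right 0. 0 < t \<and> t < r"
      using r by (auto simp: eventually_at_right_field)
    then show "\<forall>\<^sub>F t in at_right 0. t powr (- \<kappa>) * - Im (\<phi> t) / pi = t powr (- \<kappa>) * ?h (p + e * t)"
      by eventually_elim (simp add: h\<phi>)
  qed
  \<comment> \<open>The substitution \<open>x = p + e * t\<close> preserves length, so the integral
    near the endpoint is bounded by the finite mass of \<open>I\<close>.\<close>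
  have "\<kappa> > -1"
  proof (rule powr_integrable_exponent[OF lim'])
    have "(\<integral>\<^sup>+t. ennreal (?h (p + e * t)) * indicator {0<..<r} t \<partial>lborel)
        \<le> (\<integral>\<^sup>+t. ennreal (?h (p + e * t)) \<partial>lborel)"
      by (intro nn_integral_mono) (auto split: split_indicator)
    also have "\<dots> = (\<integral>\<^sup>+x. ennreal (?h x) \<partial>lborel)"
      using nn_integral_real_affine[of "\<lambda>x. ennreal (?h x)" e p] bd(3) e by auto
    also have "\<dots> = (\<integral>\<^sup>+x. ennreal (?h x) * indicator I x \<partial>lborel)"
      by (intro nn_integral_cong) (auto split: split_indicator simp: boundary_density_def)
    also have "\<dots> = emeasure M I"
      using bd(4)[of I] bd(3) I(1) by (simp add: emeasure_density)
    also have "\<dots> < \<infinity>" by (simp add: emeasure_eq_measure)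
    finally show "(\<integral>\<^sup>+t. ennreal (?h (p + e * t)) * indicator {0<..<r} t \<partial>lborel) < \<infinity>" .
  qed (use \<kappa> r in auto)
  show ?thesis
    by (rule that[of "1 + \<kappa>" "L / pi"]) (use \<kappa> \<open>\<kappa> > -1\<close> lim' in auto)
qed

lemma open_interval_of_bounded:
  fixes I :: "real set"
  assumes "open I" "is_interval I" "bounded I" "I \<noteq> {}"
  obtains a b where "a < b" "I = {a<..<b}"
proof -
  have bdd: "bdd_below I" "bdd_above I"
    using bounded_imp_bdd_below[OF assms(3)] bounded_imp_bdd_above[OF assms(3)] .
  have *: "x \<noteq> Inf I \<and> x \<noteq> Sup I" if x: "x \<in> I" for x
  proof -
    obtain e where "e > 0" "cball x e \<subseteq> I" using assms(1) x open_contains_cball by blast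
    then have "x - e \<in> I" "x + e \<in> I" by (auto simp: dist_real_def subset_iff)
    then have "Inf I \<le> x - e" "x + e \<le> Sup I" using bdd by (auto intro: cInf_lower cSup_upper)
    then show ?thesis using \<open>e > 0\<close> by auto
  qed
  have "I = {Inf I<..<Sup I}"
  proof (rule subset_antisym)
    show "I \<subseteq> {Inf I<..<Sup I}"
    proof
      fix x assume x: "x \<in> I"
      have "Inf I \<le> x" "x \<le> Sup I" using x bdd by (auto intro: cInf_lower cSup_upper)
      then show "x \<in> {Inf I<..<Sup I}" using *[OF x] by auto
    qed
    show "{Inf I<..<Sup I} \<subseteq> I"
    proof
      fix x assume x: "x \<in> {Inf I<..<Sup I}"
      obtain l where "l \<in> I" "l < x" using x bdd assms(4) cInf_less_iff[of I x] by auto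
      moreover obtain u where "u \<in> I" "x < u" using x bdd assms(4) less_cSup_iff[of I x] by auto
      ultimately show "x \<in> I" using mem_is_interval_1_I[OF assms(2), of l u x] by simp
    qed
  qed
  moreover from this have "Inf I < Sup I" using assms(4) by (metis greaterThanLessThan_empty_iff not_le)
  ultimately show ?thesis using that by metis
qed

text \<open>A null neighbourhood of \<open>x1\<close> makes the density vanish near
  \<open>x1\<close>: at a point where it is positive, continuity would give a lower bound on a short
  interval inside that neighbourhood, which would then have positive mass. The identity theorem
  extends the vanishing to \<open>I\<close>.\<close>

lemma (in real_distribution) boundary_density_zero_off_support:
  assumes I: "open I" "is_interval I" and \<delta>: "\<delta> > 0"
    and y: "y holomorphic_on {z. Re z \<in> I \<and> \<bar>Im z\<bar> < \<delta>}"
      "\<forall>z. Re z \<in> I \<and> 0 < Im z \<and> Im z < \<delta> \<longrightarrow> y z = stieltjes M z"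
    and x1: "x1 \<in> I" "x1 \<notin> measure_support M"
  shows "boundary_density I y x = 0"
proof -
  let ?h = "boundary_density I y"
  note cont = holomorphic_on_imp_continuous_on[OF y(1)]
  note bd = boundary_density_nonneg[OF I \<delta> cont y(2)] boundary_density_measurable[OF I \<delta> cont y(2)]
    emeasure_boundary_density[OF I \<delta> cont y(2)] continuous_on_strip_axis[OF \<delta> cont]
  obtain U where U: "open U" "x1 \<in> U" "emeasure M U = 0"
    using x1(2) by (auto simp: measure_support_def)
  have "open (U \<inter> I)" "x1 \<in> U \<inter> I" using U I x1 by auto
  then obtain e where e: "e > 0" "ball x1 e \<subseteq> U \<inter> I" by (meson openE)
  have ball: "ball x1 e = {x1 - e<..<x1 + e}" by (rule ball_eq_greaterThanLessThan)
  have hcont: "continuous_on I ?h"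
  proof (rule continuous_on_eq)
    show "continuous_on I (\<lambda>x. - Im (y (of_real x)) / pi)"
      by (intro continuous_intros bd(4)) simp_all
  qed (simp add: boundary_density_def)
  show ?thesis
  proof (rule boundary_density_zero[OF I \<delta> y(1), of "x1 - e" "x1 + e"])
    show "x1 - e < x1 + e" using e by simp
    show "{x1 - e<..<x1 + e} \<subseteq> I" using e(2) unfolding ball by blast
    fix x2 assume x2: "x2 \<in> {x1 - e<..<x1 + e}"
    show "?h x2 = 0"
    proof (rule ccontr)
      assume "?h x2 \<noteq> 0"
      then have pos: "?h x2 > 0" using bd(1)[of x2] by simp
      have x2I: "x2 \<in> I" using x2 e(2) unfolding ball by blast
      have "isCont ?h x2" using hcont I(1) x2I by (simp add: continuous_on_eq_continuous_at)
      then have "(?h \<longlongrightarrow> ?h x2) (nhds x2)" by (rule isCont_tendsto_nhds)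
      then have "\<forall>\<^sub>F x in nhds x2. ?h x2 / 2 < ?h x" by (rule order_tendstoD) (use pos in simp)
      moreover have "\<forall>\<^sub>F x in nhds x2. x \<in> ball x1 e"
        using x2 unfolding ball by (intro eventually_nhds_in_open) auto
      ultimately have "\<forall>\<^sub>F x in nhds x2. ?h x2 / 2 < ?h x \<and> x \<in> ball x1 e" by (rule eventually_conj)
      then obtain d where d: "d > 0" "\<forall>x. dist x x2 < d \<longrightarrow> ?h x2 / 2 < ?h x \<and> x \<in> ball x1 e"
        unfolding eventually_nhds_metric by (elim exE conjE)
      \<comment> \<open>Half-width \<open>d / 2\<close> keeps \<open>B\<close> strictly inside the
        \<open>d\<close>-neighbourhood of \<open>x2\<close> and makes its length
        \<open>d\<close>.\<close>
      define B where "B = {x2 - d / 2..x2 + d / 2}"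
      have B: "?h x2 / 2 < ?h x" "x \<in> U" "x \<in> I" if "x \<in> B" for x
      proof -
        have "dist x x2 < d" using that d(1) by (auto simp: B_def dist_real_def)
        then have "?h x2 / 2 < ?h x \<and> x \<in> ball x1 e" using d(2) by simp
        then show "?h x2 / 2 < ?h x" "x \<in> U" "x \<in> I" using e(2) by blast+
      qed
      have "ennreal (?h x2 / 2) * ennreal d = (\<integral>\<^sup>+x. ennreal (?h x2 / 2) * indicator B x \<partial>lborel)"
        using d by (simp add: nn_integral_cmult B_def)
      also have "\<dots> \<le> (\<integral>\<^sup>+x. ennreal (?h x) * indicator B x \<partial>lborel)"
        using B(1) by (intro nn_integral_mono) (auto split: split_indicator intro!: ennreal_leI simp: less_imp_le)
      also have "\<dots> = emeasure M B"
      proof -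
        have "B \<subseteq> I" using B(3) by blast
        then show ?thesis using bd(3)[of B] bd(2) by (simp add: emeasure_density B_def)
      qed
      also have "\<dots> \<le> emeasure M U"
        using B(2) U(1) by (intro emeasure_mono) auto
      finally have "ennreal (?h x2 / 2) * ennreal d = 0" using U(3) by simp
      then show False using pos d(1) by (simp add: ennreal_eq_0_iff)
    qed
  qed
qed

section \<open>Conclusion for a component of the real line without \<open>A\<close>\<close>

theorem theorem2p9:
  fixes \<mu> :: "real measure" and K :: "real set"
    and F :: "complex poly poly" and A :: "complex set" and I :: "real set"
  assumes "real_distribution \<mu>"
    and "K = measure_support \<mu>" and "compact K"
    and "algebraic_stieltjes \<mu>"
    and "F \<noteq> 0"
    and "\<forall>z. z \<notin> complex_of_real ` K \<longrightarrow> bipoly_eval F z (stieltjes \<mu> z) = 0"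
    and "discriminant F \<noteq> 0"
    and "A = {z. poly (lead_coeff F * discriminant F) z = 0}"
    and "I \<in> components {x :: real. complex_of_real x \<notin> A}"
  shows "(I - K \<noteq> {} \<longrightarrow>
            restrict_space \<mu> I = null_measure (restrict_space borel I)) \<and>
         (bounded I \<longrightarrow>
            restrict_space \<mu> I \<noteq> null_measure (restrict_space borel I) \<longrightarrow>
            (\<exists>a b h. I = {a<..<b} \<and> rational_beta_type a b h \<and>
               restrict_space \<mu> I = density (restrict_space lborel I) (\<lambda>x. ennreal (h x))))"
proof -
  interpret real_distribution \<mu> by fact
  let ?G = "{x :: real. complex_of_real x \<notin> A}"
  have G_eq: "?G = complex_of_real -` regular_points F"
    unfolding assms(8) regular_points_def by auto
  have "open ?G"
    unfolding G_eq by (rule open_vimage[OF open_regular_points]) (intro continuous_intros)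
  then have "open I" using assms(9) by (rule open_components)
  have "is_interval I" using in_components_connected[OF assms(9)] by (simp add: is_interval_connected_1)
  note I = \<open>open I\<close> \<open>is_interval I\<close>
  have I_ne: "I \<noteq> {}" using in_components_nonempty[OF assms(9)] .
  have I_reg: "complex_of_real x \<in> regular_points F" if "x \<in> I" for x
    using in_components_subset[OF assms(9)] that unfolding G_eq by blast
  note fin = finite_nonregular_points[OF assms(5,7)]
  \<comment> \<open>The support is real, so the equation holds on the whole upper half-plane
    whatever the position of \<open>K\<close> relative to \<open>I\<close>.\<close>
  have root: "bipoly_eval F z (stieltjes \<mu> z) = 0" if "Im z > 0" for z
  proof -
    have "z \<notin> complex_of_real ` K" using that by auto
    then show ?thesis using assms(6) by blast
  qed
  have "infinite (range (\<lambda>n::nat. Complex (real n) 1))"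
    by (rule range_inj_infinite) (auto simp: inj_def)
  moreover have "range (\<lambda>n::nat. Complex (real n) 1) \<subseteq> {z. Im z > 0}" by auto
  ultimately have inf: "infinite {z. Im z > 0}" by (rule infinite_super[rotated])
  have deg: "degree F > 0"
    by (rule degree_pos_of_roots[OF assms(5) inf]) (use root in simp)
  obtain \<delta> where \<delta>: "\<delta> > 0" "{z. Re z \<in> I \<and> \<bar>Im z\<bar> < \<delta>} \<subseteq> regular_points F"
    using regular_strip[OF fin, of I] I_reg by blast
  obtain y where y: "y holomorphic_on {z. Re z \<in> I \<and> \<bar>Im z\<bar> < \<delta>}"
    "\<forall>z. Re z \<in> I \<and> \<bar>Im z\<bar> < \<delta> \<longrightarrow> bipoly_eval F z (y z) = 0"
    "\<forall>z. Re z \<in> I \<and> 0 < Im z \<and> Im z < \<delta> \<longrightarrow> y z = stieltjes \<mu> z"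
    using stieltjes_lift_strip[OF deg I I_ne \<delta> root] by metis
  let ?h = "boundary_density I y"
  note cont = holomorphic_on_imp_continuous_on[OF y(1)]
  note dens = restrict_space_eq_boundary_density[OF I \<delta>(1) cont y(3)]
  \<comment> \<open>In contrapositive form this produces a point of nonzero density, the hypothesis
    of the estimate at either endpoint.\<close>
  have null: "restrict_space \<mu> I = null_measure (restrict_space borel I)" if "\<And>x. ?h x = 0"
  proof (rule measure_eqI)
    show "emeasure (restrict_space \<mu> I) X = emeasure (null_measure (restrict_space borel I)) X" for X
      unfolding dens that by (simp add: null_measure_eq_density[symmetric])
  qed (simp add: sets_restrict_space)
  show ?thesis
  proof (intro conjI impI)
    assume "I - K \<noteq> {}"
    then obtain x1 where "x1 \<in> I" "x1 \<notin> measure_support \<mu>" using assms(2) by blast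
    then show "restrict_space \<mu> I = null_measure (restrict_space borel I)"
      by (intro null boundary_density_zero_off_support[OF I \<delta>(1) y(1,3)])
  next
    assume "bounded I" and "restrict_space \<mu> I \<noteq> null_measure (restrict_space borel I)"
    then obtain x0 where x0: "?h x0 \<noteq> 0" using null by blast
    obtain a b where ab: "a < b" "I = {a<..<b}"
      using open_interval_of_bounded[OF I \<open>bounded I\<close> I_ne] .
    note edge = boundary_density_edge[OF deg fin I \<delta>(1) y]
    obtain c L where c: "c \<in> \<rat>" "c > 0" "L > 0"
      "((\<lambda>t. t powr (1 - c) * ?h (a + 1 * t)) \<longlongrightarrow> L) (at_right 0)"
    proof (rule edge[of 1 "b - a" a, OF _ _ _ x0])
      show "a + 1 * t \<in> I" if "0 < t" "t < b - a" for t using that by (simp add: ab)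
    qed (use ab that in auto)
    obtain d L' where d: "d \<in> \<rat>" "d > 0" "L' > 0"
      "((\<lambda>t. t powr (1 - d) * ?h (b + - 1 * t)) \<longlongrightarrow> L') (at_right 0)"
    proof (rule edge[of "- 1" "b - a" b, OF _ _ _ x0])
      show "b + - 1 * t \<in> I" if "0 < t" "t < b - a" for t using that by (simp add: ab)
    qed (use ab that in auto)
    have "\<exists>L>0. ((\<lambda>x. (x - a) powr (1 - c) * ?h x) \<longlongrightarrow> L) (at_right a)"
      unfolding filterlim_at_right_to_0[of _ _ a]
      by (rule exI[of _ L]) (use c(3,4) in \<open>simp add: add.commute\<close>)
    moreover have "\<exists>L>0. ((\<lambda>x. (b - x) powr (1 - d) * ?h x) \<longlongrightarrow> L) (at_left b)"
      \<comment> \<open>The left limit at \<open>b\<close> is reflected to a right limit at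
        \<open>- b\<close> and then shifted to \<open>0\<close>, where the variable is
        \<open>t = b - x\<close>.\<close>
      unfolding filterlim_at_left_to_right[of _ _ b] filterlim_at_right_to_0[of _ _ "- b"]
      by (rule exI[of _ L']) (use d(3,4) in \<open>simp add: algebra_simps\<close>)
    moreover have "real_analytic_on ?h {a<..<b}"
      using boundary_density_analytic[OF I(1) \<delta>(1) y(1)] ab by simp
    moreover have "\<forall>x\<in>{a<..<b}. 0 \<le> ?h x"
      using boundary_density_nonneg[OF I \<delta>(1) cont y(3)] by simp
    ultimately have "rational_beta_type a b ?h"
      unfolding rational_beta_type_def using ab(1) c(1,2) d(1,2) by blast
    then show "\<exists>a b h. I = {a<..<b} \<and> rational_beta_type a b h \<and>
        restrict_space \<mu> I = density (restrict_space lborel I) (\<lambda>x. ennreal (h x))"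
      by (intro exI[of _ a] exI[of _ b] exI[of _ ?h] conjI ab(2) dens)
  qed
qed

end
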